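(* Let $d\ge 1$, $0<\alpha\le 2$, and let $V\in L^{\infty}(\mathbb{R}^d)\cap L^{1}(\mathbb{R}^d)$ be real-valued. Let $Q_V^{(\alpha)}(t)$ be the heat content of $H_V=(-\Delta)^{\alpha/2}+V$. (i) If $V:\mathbb{R}^d\to(-\infty,0]$, then for all $t>0$ $$-t\int_{\mathbb{R}^d} V(x)\,dx\;\le\; Q_V^{(\alpha)}(t)\;\le\; -t\int_{\mathbb{R}^d} V(x)\,dx\,\Bigl(1+\tfrac12\, t\,\|V\|_\infty e^{t\|V\|_\infty}\Bigr).$$ The last inequality implies that $Q_V^{(\alpha)}(t)=-t\int_{\mathbb{R}^d}V(x)\,dx+\mathcal{O}(t^2)$ as $t\downarrow 0$. (ii) For $V\in L^{\infty}(\mathbb{R}^d)\cap L^{1}(\mathbb{R}^d)$ (of arbitrary sign), for all $t>0$ $$\Bigl|Q_V^{(\alpha)}(t)+t\int_{\mathbb{R}^d}V(x)\,dx\Bigr|\le t^2\,\|V\|_1\,\|V\|_\infty\, e^{t\|V\|_\infty}.$$ In particular, $Q_V^{(\alpha)}(t)=-t\int_{\mathbb{R}^d}V(x)\,dx+\mathcal{O}(t^2)$ as $t\downarrow 0$.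
   Context: $X=\{X_t\}_{t\ge0}$ is the rotationally invariant $\alpha$-stable process on $\mathbb{R}^d$, with transition densities $p_t^{(\alpha)}(x,y)=p_t^{(\alpha)}(x-y)$ determined by $e^{-t|\xi|^\alpha}=\int_{\mathbb{R}^d}e^{-i y\cdot\xi}p_t^{(\alpha)}(y)\,dy$ for $t>0$, $\xi\in\mathbb{R}^d$. $\mathbb{E}^t_{x,y}$ denotes expectation with respect to the stable bridge, i.e. the process started at $x$ and conditioned to be at $y$ at time $t$; for $1=\lambda_0>\lambda_1>\dots>\lambda_k>\lambda_{k+1}=0$, $z_0=x$, $z_{k+1}=y$, the law of $(X_{t\lambda_1},\dots,X_{t\lambda_k})$ under it has density $\frac{1}{p_t^{(\alpha)}(x,y)}\prod_{j=0}^{k}p^{(\alpha)}_{t(\lambda_j-\lambda_{j+1})}(z_j,z_{j+1})$. The heat kernel of $e^{-tH_V}$, $H_V=(-\Delta)^{\alpha/2}+V$, is given by the Feynman–Kac formula $p_t^{H_V}(x,y)=p_t^{(\alpha)}(x,y)\,\mathbb{E}^t_{x,y}\bigl[e^{-\int_0^tV(X_s)ds}\bigr]$. The heat content is $$Q_V^{(\alpha)}(t)=\int_{\mathbb{R}^d}\int_{\mathbb{R}^d}\bigl\{p_t^{H_V}(x,y)-p_t^{(\alpha)}(x,y)\bigr\}dx\,dy=\int_{\mathbb{R}^d}\int_{\mathbb{R}^d}p_t^{(\alpha)}(x,y)\,\mathbb{E}^t_{x,y}\bigl[e^{-\int_0^tV(X_s)ds}-1\bigr]dx\,dy.$$ $\|\cdot\|_1,\|\cdot\|_\infty$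 are the $L^1(\mathbb{R}^d)$ and $L^\infty(\mathbb{R}^d)$ norms. *)

theory Defs
  imports "HOL-Probability.Probability" "HOL-Library.Landau_Symbols"
begin

text \<open>
  The Euclidean space is an arbitrary type of class \<open>euclidean_space\<close>, so \<open>d = DIM('a) \<ge> 1\<close>.
  \<open>L\<^sup>p\<close> functions are given by Borel representatives, so that \<open>V\<close> can be composed with a process
  on a probability space that need not be complete.
\<close>

definition Linf :: "('a::euclidean_space \<Rightarrow> real) \<Rightarrow> bool" where
  "Linf V \<longleftrightarrow> V \<in> borel_measurable lborel \<and> esssup lborel (\<lambda>x. ereal \<bar>V x\<bar>) < \<infinity>"

definition Linf_norm :: "('a::euclidean_space \<Rightarrow> real) \<Rightarrow> real" where
  "Linf_norm V = real_of_ereal (esssup lborel (\<lambda>x. ereal \<bar>V x\<bar>))"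

definition L1_norm :: "('a::euclidean_space \<Rightarrow> real) \<Rightarrow> real" where
  "L1_norm V = (LBINT x. \<bar>V x\<bar>)"

text \<open>
  The Fourier identity determines \<open>p t\<close> almost everywhere; continuity selects the version that
  the pointwise values used in the bridge laws refer to.
\<close>

definition stable_transition_density :: "real \<Rightarrow> (real \<Rightarrow> 'a::euclidean_space \<Rightarrow> real) \<Rightarrow> bool" where
  "stable_transition_density \<alpha> p \<longleftrightarrow>
     (\<forall>t>0. continuous_on UNIV (p t) \<and> (\<forall>y. 0 \<le> p t y) \<and> integrable lborel (p t) \<and>
        (\<forall>\<xi>. (LBINT y. exp (- \<i> * complex_of_real (y \<bullet> \<xi>)) * complex_of_real (p t y)) =
              complex_of_real (exp (- t * norm \<xi> powr \<alpha>))))"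

definition cadlag_on :: "real \<Rightarrow> (real \<Rightarrow> 'a::topological_space) \<Rightarrow> bool" where
  "cadlag_on t f \<longleftrightarrow>
     (\<forall>s\<in>{0..<t}. (f \<longlongrightarrow> f s) (at_right s)) \<and>
     (\<forall>s\<in>{0<..t}. \<exists>l. (f \<longlongrightarrow> l) (at_left s))"

text \<open>
  Joint density of the bridge from \<open>x\<close> to \<open>y\<close> at the times \<open>s 1 < \<dots> < s k\<close>, where \<open>s 0 = 0\<close> and
  \<open>s (k + 1) = t\<close>; the path \<open>z 1, \<dots>, z k\<close> is completed by \<open>z 0 = x\<close> and \<open>z (k + 1) = y\<close>.
\<close>

definition bridge_density ::
  "(real \<Rightarrow> 'a::euclidean_space \<Rightarrow> real) \<Rightarrow> real \<Rightarrow> 'a \<Rightarrow> 'a \<Rightarrow> nat \<Rightarrow> (nat \<Rightarrow> real) \<Rightarrow> (nat \<Rightarrow> 'a) \<Rightarrow> real"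
where
  "bridge_density p t x y k s z =
     (let w = z(0 := x, Suc k := y)
      in 1 / p t (x - y) * (\<Prod>j=0..k. p (s (Suc j) - s j) (w j - w (Suc j))))"

text \<open>
  \<open>X\<close> restricted to times in \<open>{0..t}\<close> is, under \<open>M\<close>, a realization with cadlag paths of the process
  started at \<open>x\<close> and conditioned to be at \<open>y\<close> at time \<open>t\<close>. The finite-dimensional laws are listed
  in increasing time order, so that \<open>z 0 = x\<close> is the position at time \<open>0\<close>.
\<close>

definition stable_bridge ::
  "(real \<Rightarrow> 'a::euclidean_space \<Rightarrow> real) \<Rightarrow> real \<Rightarrow> 'a \<Rightarrow> 'a \<Rightarrow> 'w measure \<Rightarrow> (real \<Rightarrow> 'w \<Rightarrow> 'a) \<Rightarrow> bool"
where
  "stable_bridge p t x y M X \<longleftrightarrow>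
     prob_space M \<and>
     (\<forall>s\<in>{0..t}. X s \<in> borel_measurable M) \<and>
     (\<forall>\<omega>\<in>space M. cadlag_on t (\<lambda>s. X s \<omega>)) \<and>
     (AE \<omega> in M. X 0 \<omega> = x) \<and> (AE \<omega> in M. X t \<omega> = y) \<and>
     (\<forall>k s. 1 \<le> k \<longrightarrow> s 0 = 0 \<longrightarrow> s (Suc k) = t \<longrightarrow> (\<forall>j\<le>k. s j < s (Suc j)) \<longrightarrow>
        distributed M (\<Pi>\<^sub>M j\<in>{1..k}. lborel) (\<lambda>\<omega>. \<lambda>j\<in>{1..k}. X (s j) \<omega>)
          (\<lambda>z. ennreal (bridge_density p t x y k s z)))"

text \<open>
  The heat kernel of \<open>H\<^sub>V\<close> by the Feynman-Kac formula. \<open>P t x y\<close> is the law of the bridge from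
  \<open>x\<close> to \<open>y\<close> of length \<open>t\<close>, on which \<open>X\<close> is the process.
\<close>

definition heat_kernel ::
  "(real \<Rightarrow> 'a::euclidean_space \<Rightarrow> real) \<Rightarrow> (real \<Rightarrow> 'a \<Rightarrow> 'a \<Rightarrow> 'w measure) \<Rightarrow> (real \<Rightarrow> 'w \<Rightarrow> 'a) \<Rightarrow>
   ('a \<Rightarrow> real) \<Rightarrow> real \<Rightarrow> 'a \<Rightarrow> 'a \<Rightarrow> real"
where
  "heat_kernel p P X V t x y =
     p t (x - y) * (\<integral>\<omega>. exp (- (LBINT s:{0..t}. V (X s \<omega>))) \<partial>(P t x y))"

definition heat_content ::
  "(real \<Rightarrow> 'a::euclidean_space \<Rightarrow> real) \<Rightarrow> (real \<Rightarrow> 'a \<Rightarrow> 'a \<Rightarrow> 'w measure) \<Rightarrow> (real \<Rightarrow> 'w \<Rightarrow> 'a) \<Rightarrow>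
   ('a \<Rightarrow> real) \<Rightarrow> real \<Rightarrow> real"
where
  "heat_content p P X V t = (LBINT x. (LBINT y. heat_kernel p P X V t x y - p t (x - y)))"

end

theory Submission
  imports Defs
begin

text \<open>
  Write \<open>A\<close> for the integral of \<open>V\<close> along the bridge. Since \<open>p s\<close> has mass one for every \<open>s\<close>, integrating
  the one-dimensional bridge law over both end points gives Lebesgue measure; by Fubini,
  integrating \<open>p t (x - y) * E A\<close> over \<open>x\<close> and \<open>y\<close> gives \<open>t\<close> times the integral of \<open>V\<close>. Both parts then
  follow from \<open>0 \<le> exp (- A) - 1 + A \<le> \<bar>A\<bar> * b * exp b / 2\<close> with \<open>b = t * \<parallel>V\<parallel>\<close>, where \<open>\<bar>A\<bar>\<close> is at most
  the integral of \<open>\<bar>V\<bar>\<close>.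

  The laws \<open>P t x y\<close> are not assumed to depend measurably on \<open>(x, y)\<close>. Measurability of the expectations
  follows for continuous \<open>V\<close> from the finite-dimensional densities, since right-continuity of the
  paths allows time to be discretized, and extends to bounded Borel \<open>V\<close> because these are the
  closure of the bounded continuous functions under bounded pointwise limits.
\<close>

subsection \<open>Bounded Borel functions as bounded limits of continuous functions\<close>

text \<open>The uniform constant \<open>C\<close> in \<open>limit\<close> is what dominated
  convergence on a probability space asks for. A property of expectations that survives such limits
  then has to be checked for continuous functions only.\<close>

inductive bounded_baire :: "('a::metric_space \<Rightarrow> real) \<Rightarrow> bool" where
  continuous: "continuous_on UNIV f \<Longrightarrow> bounded (range f) \<Longrightarrow> bounded_baire f"
| limit: "(\<And>n. bounded_baire (u n)) \<Longrightarrow> (\<And>n x. \<bar>u n x\<bar> \<le> C) \<Longrightarrow>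
    (\<And>x. (\<lambda>n. u n x) \<longlonglongrightarrow> f x) \<Longrightarrow> bounded_baire f"

lemma bounded_baire_const: "bounded_baire (\<lambda>x. c)" for c :: real
  by (rule bounded_baire.continuous) auto

lemma bounded_baire_cmult:
  assumes "bounded_baire f" shows "bounded_baire (\<lambda>x. c * f x)"
  using assms
proof induction
  case (continuous f)
  then obtain B where "\<And>x. \<bar>f x\<bar> \<le> B" by (auto simp: bounded_iff)
  then have "\<bar>c * f x\<bar> \<le> \<bar>c\<bar> * B" for x by (simp add: abs_mult mult_left_mono)
  then have "bounded (range (\<lambda>x. c * f x))" by (auto simp: bounded_iff)
  with continuous show ?case by (intro bounded_baire.continuous continuous_intros)
next
  case (limit u C f)
  show ?case
  proof (rule bounded_baire.limit[of "\<lambda>n x. c * u n x"])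
    show "\<bar>c * u n x\<bar> \<le> \<bar>c\<bar> * C" for n x
      using limit(2) by (auto simp: abs_mult intro: mult_left_mono)
  qed (use limit in \<open>auto intro: tendsto_intros\<close>)
qed

lemma bounded_baire_bounded:
  assumes "bounded_baire f" shows "bounded (range f)"
  using assms
proof induction
  case (limit u C f)
  have "\<bar>f x\<bar> \<le> C" for x
    by (rule Lim_bounded[OF tendsto_rabs[OF limit(3)], of 0]) (use limit(2) in auto)
  then show ?case by (auto simp: bounded_iff)
qed

text \<open>The approximations of two functions cannot be run through in a single induction. One
  summand is held fixed while the induction runs over the other: first with a continuous fixed
  summand (\<open>cont\<close>), then, after commuting the sum, with an arbitrary one.\<close>

lemma bounded_baire_add:
  assumes "bounded_baire f" "bounded_baire g" shows "bounded_baire (\<lambda>x. f x + g x)"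
proof -
  have step: "bounded_baire (\<lambda>x. v x + g x)"
    if g: "bounded_baire g" and v: "bounded (range v)"
      and base: "\<And>w. continuous_on UNIV w \<Longrightarrow> bounded (range w) \<Longrightarrow> bounded_baire (\<lambda>x. v x + w x)"
    for v g :: "'a \<Rightarrow> real"
    using g
  proof induction
    case (continuous w) then show ?case by (rule base)
  next
    case (limit u C w)
    obtain B where B: "\<And>x. \<bar>v x\<bar> \<le> B" using v by (auto simp: bounded_iff)
    show ?case
    proof (rule bounded_baire.limit[of "\<lambda>n x. v x + u n x"])
      show "\<bar>v x + u n x\<bar> \<le> B + C" for n x
        using limit(2)[of n x] B[of x] by linarith
    qed (use limit in \<open>auto intro: tendsto_intros\<close>)
  qed
  have cont: "bounded_baire (\<lambda>x. v x + w x)"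
    if "bounded_baire w" "continuous_on UNIV v" "bounded (range v)" for v w :: "'a \<Rightarrow> real"
    using that(1,3)
  proof (rule step)
    fix w :: "'a \<Rightarrow> real" assume "continuous_on UNIV w" "bounded (range w)"
    then show "bounded_baire (\<lambda>x. v x + w x)"
      using that by (intro bounded_baire.continuous continuous_intros bounded_plus_comp)
  qed
  show ?thesis
    using assms(2) bounded_baire_bounded[OF assms(1)]
  proof (rule step)
    fix w :: "'a \<Rightarrow> real" assume "continuous_on UNIV w" "bounded (range w)"
    from cont[OF assms(1) this] show "bounded_baire (\<lambda>x. f x + w x)"
      by (simp add: add.commute)
  qed
qed

lemma bounded_baire_indicator_open:
  assumes "open U" shows "bounded_baire (indicator U)"
proof (cases "U = UNIV")
  \<comment> \<open>The distance to the empty set is 0 by convention, so the approximants used for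
    proper open sets would vanish identically here.\<close>
  case True then show ?thesis using bounded_baire_const[of 1] by (simp add: indicator_def[abs_def])
next
  case False
  \<comment> \<open>These functions vanish off \<open>U\<close> and reach 1 at a point of
    \<open>U\<close> once \<open>n\<close> exceeds the reciprocal of its positive distance to the
    closed complement.\<close>
  define u where "u n x = min 1 (real n * infdist x (- U))" for n x
  show ?thesis
  proof (rule bounded_baire.limit)
    fix n x
    show b: "\<bar>u n x\<bar> \<le> 1" for n x by (auto simp: u_def infdist_nonneg)
    show "bounded_baire (u n)"
      using b by (intro bounded_baire.continuous) 
        (auto simp: u_def[abs_def] bounded_iff intro!: continuous_intros exI[of _ 1])
    show "(\<lambda>n. u n x) \<longlonglongrightarrow> indicator U x"
    proof (cases "x \<in> U")
      case True
      have pos: "infdist x (- U) > 0"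
        using True \<open>open U\<close> False in_closed_iff_infdist_zero[of "- U" x] infdist_nonneg[of x "- U"]
        by (auto simp: closed_Compl less_le)
      obtain N where N: "1 < real N * infdist x (- U)"
        using reals_Archimedean3[OF pos] by blast
      have "eventually (\<lambda>n. u n x = 1) sequentially"
        using eventually_ge_at_top[of N]
      proof eventually_elim
        case (elim n)
        have "real N * infdist x (- U) \<le> real n * infdist x (- U)"
          using elim pos by (intro mult_right_mono) auto
        with N show ?case by (simp add: u_def)
      qed
      with True show ?thesis by (simp add: tendsto_eventually)
    next
      case False then show ?thesis by (simp add: u_def)
    qed
  qed
qed

text \<open>Open sets are stable under intersection and generate the Borel sets, so by Dynkin's
  argument complements and disjoint unions suffice. Disjointness keeps the partial sums of
  indicators bounded by 1.\<close>

lemma bounded_baire_indicator: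
  fixes A :: "'a::metric_space set"
  assumes "A \<in> sets borel" shows "bounded_baire (indicator A)"
proof -
  have "Int_stable {S :: 'a set. open S}" by (auto simp: Int_stable_def)
  moreover have "{S :: 'a set. open S} \<subseteq> Pow UNIV" by simp
  moreover have "A \<in> sigma_sets UNIV {S. open S}" using assms by (simp add: borel_def)
  ultimately show ?thesis
  proof (induction rule: sigma_sets_induct_disjoint)
    case (basic A) then show ?case by (simp add: bounded_baire_indicator_open)
  next
    case empty show ?case using bounded_baire_const[of 0] by (simp add: indicator_def[abs_def])
  next
    case (compl A)
    have "(indicator (UNIV - A) :: 'a \<Rightarrow> real) = (\<lambda>x. 1 + (- 1) * indicator A x)"
      by (auto simp: fun_eq_iff indicator_def)
    then show ?case
      using bounded_baire_add[OF bounded_baire_const[of 1] bounded_baire_cmult[OF compl(2), of "- 1"]]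
      by simp
  next
    case (union A)
    have fin: "bounded_baire (\<lambda>x. \<Sum>i<n. indicator (A i) x)" for n
      by (induction n) (use union in \<open>auto intro: bounded_baire_const bounded_baire_add\<close>)
    show ?case
    proof (rule bounded_baire.limit[OF fin])
      fix x n
      show "(\<lambda>n. \<Sum>i<n. indicator (A i) x :: real) \<longlonglongrightarrow> indicator (\<Union> (range A)) x"
        using sums_def indicator_sums union(1) by (metis disjoint_family_onD UNIV_I)
      show "\<bar>\<Sum>i<n. indicator (A i) x :: real\<bar> \<le> 1"
      proof -
        have "(\<Sum>i<n. indicator (A i) x :: real) = indicator (\<Union>i<n. A i) x"
          using union(1) by (intro indicator_UN_disjoint[symmetric]) (auto simp: disjoint_family_on_def)
        then show ?thesis by simp
      qed
    qed
  qed
qed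

lemma bounded_baire_borel:
  fixes f :: "'a::metric_space \<Rightarrow> real"
  assumes f: "f \<in> borel_measurable borel" and C: "\<And>x. \<bar>f x\<bar> \<le> C"
  shows "bounded_baire f"
proof -
  \<comment> \<open>The induction ranges over all nonnegative Borel functions, so boundedness is a
    premise inside the claim. Nonnegativity passes it from a sum to its summands and from a limit to
    the increasing sequence below it.\<close>
  have pos: "bounded (range g) \<longrightarrow> bounded_baire g"
    if "g \<in> borel_measurable borel" "\<And>x. 0 \<le> g x" for g :: "'a \<Rightarrow> real"
    using that
  proof (induction rule: borel_measurable_induct_real)
    case (set A) then show ?case by (simp add: bounded_baire_indicator)
  next
    case (mult u c)
    show ?case
    proof (cases "c = 0")
      \<comment> \<open>With factor 0, boundedness of the product says nothing about
        \<open>u\<close>.\<close>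
      case True then show ?thesis by (simp add: bounded_baire_const)
    next
      case False
      show ?thesis
      proof
        assume "bounded (range (\<lambda>x. c * u x))"
        then obtain B where "\<And>x. \<bar>c * u x\<bar> \<le> B" by (auto simp: bounded_iff)
        then have "\<bar>u x\<bar> \<le> B / \<bar>c\<bar>" for x
          using False by (simp add: abs_mult field_simps)
        then have "bounded (range u)" by (auto simp: bounded_iff)
        with mult show "bounded_baire (\<lambda>x. c * u x)" by (simp add: bounded_baire_cmult)
      qed
    qed
  next
    case (add u v)
    show ?case
    proof
      assume "bounded (range (\<lambda>x. v x + u x))"
      then obtain B where B: "\<And>x. \<bar>v x + u x\<bar> \<le> B" by (auto simp: bounded_iff)
      have "\<bar>u x\<bar> \<le> B" "\<bar>v x\<bar> \<le> B" for x
        using B[of x] add(2)[of x] add(5)[of x] by auto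
      then have "bounded (range u)" "bounded (range v)" by (auto simp: bounded_iff)
      with add show "bounded_baire (\<lambda>x. v x + u x)" by (simp add: bounded_baire_add)
    qed
  next
    case (seq U)
    show ?case
    proof
      assume "bounded (range g)"
      then obtain B where B: "\<And>x. \<bar>g x\<bar> \<le> B" by (auto simp: bounded_iff)
      have "U i x \<le> g x" for i x
        using seq(3,4) by (intro incseq_le) (auto simp: incseq_def le_fun_def)
      with seq(2) have UB: "\<bar>U i x\<bar> \<le> B" for i x
        using B[of x] by (metis abs_le_iff abs_of_nonneg order_trans)
      then have "bounded (range (U i))" for i by (auto simp: bounded_iff)
      with seq have "bounded_baire (U i)" for i by blast
      then show "bounded_baire g" by (rule bounded_baire.limit[OF _ UB seq(4)]) simp
    qed
  qed
  have "bounded_baire (\<lambda>x. f x + C)"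
  proof -
    have "0 \<le> f x + C" for x using C[of x] by linarith
    moreover have "bounded (range (\<lambda>x. f x + C))"
      using C by (intro bounded_plus_comp) (auto simp: bounded_iff)
    ultimately show ?thesis using pos[of "\<lambda>x. f x + C"] f by simp
  qed
  from bounded_baire_add[OF this bounded_baire_const[of "- C"]] show ?thesis by simp
qed

text \<open>Dominated convergence also asks for measurable approximants. The induction therefore
  carries measurability along with \<open>Q\<close> and offers it in the limit case.\<close>

lemma bounded_borel_induct [consumes 2, case_names continuous limit]:
  fixes f :: "'a::metric_space \<Rightarrow> real"
  assumes "f \<in> borel_measurable borel" and "\<And>x. \<bar>f x\<bar> \<le> C"
    and cont: "\<And>g. continuous_on UNIV g \<Longrightarrow> bounded (range g) \<Longrightarrow> Q g"
    and lim: "\<And>u g B. (\<And>n. u n \<in> borel_measurable borel) \<Longrightarrow> (\<And>n x. \<bar>u n x\<bar> \<le> B) \<Longrightarrow>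
      (\<And>n. Q (u n)) \<Longrightarrow> (\<And>x. (\<lambda>n. u n x) \<longlonglongrightarrow> g x) \<Longrightarrow> Q g"
  shows "Q f"
proof -
  have "f \<in> borel_measurable borel \<and> Q f"
    using bounded_baire_borel[OF assms(1,2)]
  proof induction
    case (continuous g) then show ?case by (auto intro: cont borel_measurable_continuous_onI)
  next
    case (limit u B g)
    then show ?case
      by (auto intro: lim[of u B g] borel_measurable_LIMSEQ_real[where u=u])
  qed
  then show ?thesis ..
qed

subsection \<open>Finite-dimensional laws of the bridges\<close>

text \<open>The grid point is the least multiple of \<open>1 / Suc n\<close> strictly above
  \<open>s\<close>. Floor plus one, unlike the ceiling, stays strict when \<open>s\<close> lies on
  the grid, and a limit from the right needs strictness.\<close>

lemma upper_grid_gt: "s < (of_int \<lfloor>s * real (Suc n)\<rfloor> + 1) / real (Suc n)"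
proof -
  have "s * real (Suc n) < of_int \<lfloor>s * real (Suc n)\<rfloor> + 1" by linarith
  then show ?thesis by (simp add: pos_less_divide_eq del: of_nat_Suc)
qed

lemma upper_grid_tendsto: "(\<lambda>n. (of_int \<lfloor>s * real (Suc n)\<rfloor> + 1) / real (Suc n)) \<longlonglongrightarrow> s"
proof (rule tendsto_sandwich[of "\<lambda>_. s"])
  show "eventually (\<lambda>n. (of_int \<lfloor>s * real (Suc n)\<rfloor> + 1) / real (Suc n) \<le> s + 1 / real (Suc n)) sequentially"
  proof (intro always_eventually allI)
    fix n
    have "of_int \<lfloor>s * real (Suc n)\<rfloor> + 1 \<le> s * real (Suc n) + 1" by linarith
    also have "\<dots> = (s + 1 / real (Suc n)) * real (Suc n)" by (simp add: distrib_right)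
    finally show "(of_int \<lfloor>s * real (Suc n)\<rfloor> + 1) / real (Suc n) \<le> s + 1 / real (Suc n)"
      by (simp add: pos_divide_le_eq del: of_nat_Suc)
  qed
  show "(\<lambda>n. s + 1 / real (Suc n)) \<longlonglongrightarrow> s"
    using tendsto_add[OF tendsto_const[of s] LIMSEQ_inverse_real_of_nat] by (simp add: inverse_eq_divide)
qed (auto intro!: always_eventually less_imp_le upper_grid_gt simp del: of_nat_Suc)

text \<open>One length \<open>t\<close> is fixed while the end points vary: all estimates are made
  at fixed \<open>t\<close> and then integrated over the end points. The mass is a nonnegative
  integral, ready for Tonelli.\<close>

locale bridge_family =
  fixes p :: "real \<Rightarrow> 'a::euclidean_space \<Rightarrow> real"
    and t :: real
    and P :: "'a \<Rightarrow> 'a \<Rightarrow> 'w measure"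
    and X :: "real \<Rightarrow> 'w \<Rightarrow> 'a"
  assumes t_pos: "0 < t"
    and p_cont: "\<And>s. 0 < s \<Longrightarrow> continuous_on UNIV (p s)"
    and p_nonneg: "\<And>s y. 0 < s \<Longrightarrow> 0 \<le> p s y"
    and p_mass: "\<And>s. 0 < s \<Longrightarrow> (\<integral>\<^sup>+y. ennreal (p s y) \<partial>lborel) = 1"
    and bridge: "\<And>x y. stable_bridge p t x y (P x y) X"
begin

lemma prob_space_P: "prob_space (P x y)"
  using bridge unfolding stable_bridge_def by blast

sublocale P: prob_space "P x y" for x y by (rule prob_space_P)

lemma p_measurable: "0 < s \<Longrightarrow> p s \<in> borel_measurable borel"
  by (intro borel_measurable_continuous_onI p_cont)

lemma X_measurable: "s \<in> {0..t} \<Longrightarrow> X s \<in> borel_measurable (P x y)"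
  using bridge unfolding stable_bridge_def by blast

lemma X_start: "AE \<omega> in P x y. X 0 \<omega> = x"
  using bridge unfolding stable_bridge_def by blast

lemma X_end: "AE \<omega> in P x y. X t \<omega> = y"
  using bridge unfolding stable_bridge_def by blast

lemma X_distributed:
  assumes "1 \<le> k" "s 0 = 0" "s (Suc k) = t" "\<And>j. j \<le> k \<Longrightarrow> s j < s (Suc j)"
  shows "distributed (P x y) (\<Pi>\<^sub>M j\<in>{1..k}. lborel) (\<lambda>\<omega>. \<lambda>j\<in>{1..k}. X (s j) \<omega>)
    (\<lambda>z. ennreal (bridge_density p t x y k s z))"
  using bridge[of x y] assms unfolding stable_bridge_def by blast

text \<open>The bridge is described for times in \<open>{0..t}\<close> only. Freezing the path
  outside that interval gives a function of all real times, so that measurability can be stated over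
  \<open>lborel\<close> and grid points beyond \<open>t\<close> do no harm.\<close>

definition clamp :: "real \<Rightarrow> real" where "clamp s = max 0 (min t s)"

lemma clamp_mem: "clamp s \<in> {0..t}" using t_pos by (auto simp: clamp_def)

lemma clamp_eq: "s \<in> {0..t} \<Longrightarrow> clamp s = s" by (auto simp: clamp_def)

lemma X_clamp_measurable [measurable]: "X (clamp s) \<in> borel_measurable (P x y)"
  by (rule X_measurable[OF clamp_mem])

text \<open>Right continuity of the paths is given on \<open>[0, t)\<close>. Before 0, and from
  \<open>t\<close> onwards, the clamped path is constant to the right of \<open>s\<close>, so the
  limit exists there for a trivial reason.\<close>

lemma X_right_limit:
  assumes "\<omega> \<in> space (P x y)" and "u \<longlonglongrightarrow> s" and "\<And>n. s < u n"
  shows "(\<lambda>n. X (clamp (u n)) \<omega>) \<longlonglongrightarrow> X (clamp s) \<omega>"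
proof -
  consider "s < 0" | "t \<le> s" | "0 \<le> s" "s < t" by linarith
  then show ?thesis
  proof cases
    case 1
    then have "eventually (\<lambda>n. u n < 0) sequentially" by (rule order_tendstoD(2)[OF assms(2)])
    then have "eventually (\<lambda>n. X (clamp (u n)) \<omega> = X (clamp s) \<omega>) sequentially"
      by eventually_elim (use 1 in \<open>auto simp: clamp_def\<close>)
    then show ?thesis by (rule tendsto_eventually)
  next
    case 2
    have "X (clamp (u n)) \<omega> = X (clamp s) \<omega>" for n
      using 2 assms(3)[of n] by (auto simp: clamp_def)
    then show ?thesis by simp
  next
    case 3
    have "cadlag_on t (\<lambda>s. X s \<omega>)" using bridge assms(1) unfolding stable_bridge_def by blast
    then have right: "((\<lambda>s. X s \<omega>) \<longlongrightarrow> X s \<omega>) (at_right s)"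
      using 3 unfolding cadlag_on_def by auto
    have "filterlim u (at_right s) sequentially"
      using assms(2,3) by (auto simp: filterlim_at intro!: always_eventually less_imp_neq[symmetric])
    from filterlim_compose[OF right this] have lim: "(\<lambda>n. X (u n) \<omega>) \<longlonglongrightarrow> X s \<omega>" .
    have "eventually (\<lambda>n. u n < t) sequentially" using order_tendstoD(2)[OF assms(2) 3(2)] .
    then have "eventually (\<lambda>n. X (u n) \<omega> = X (clamp (u n)) \<omega>) sequentially"
    proof eventually_elim
      case (elim n)
      then have "u n \<in> {0..t}" using 3 assms(3)[of n] by simp
      then show ?case by (simp add: clamp_eq)
    qed
    from Lim_transform_eventually[OF lim this] show ?thesis using 3 by (simp add: clamp_def)
  qed
qed

text \<open>Evaluated at the upper grid point of the time, the path is pieced together from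
  countably many random variables and is thus jointly measurable. Right continuity recovers the path
  as the pointwise limit of these pieces.\<close>

lemma X_joint_measurable:
  "(\<lambda>z. X (clamp (fst z)) (snd z)) \<in> borel_measurable (lborel \<Otimes>\<^sub>M P x y)"
proof (rule borel_measurable_LIMSEQ_metric)
  fix n
  have "(\<lambda>z. X (clamp ((of_int i + 1) / real (Suc n))) (snd z)) \<in> borel_measurable (lborel \<Otimes>\<^sub>M P x y)" for i
    by measurable
  moreover have "(\<lambda>z. \<lfloor>fst z * real (Suc n)\<rfloor>) \<in> measurable (lborel \<Otimes>\<^sub>M P x y) (count_space UNIV)"
    by measurable
  ultimately show "(\<lambda>z :: real \<times> 'w. X (clamp ((of_int \<lfloor>fst z * real (Suc n)\<rfloor> + 1) / real (Suc n))) (snd z))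
      \<in> borel_measurable (lborel \<Otimes>\<^sub>M P x y)"
    by (rule measurable_compose_countable)
next
  fix z :: "real \<times> 'w" assume "z \<in> space (lborel \<Otimes>\<^sub>M P x y)"
  then show "(\<lambda>n. X (clamp ((of_int \<lfloor>fst z * real (Suc n)\<rfloor> + 1) / real (Suc n))) (snd z))
      \<longlonglongrightarrow> X (clamp (fst z)) (snd z)"
    by (intro X_right_limit[of _ x y] upper_grid_gt upper_grid_tendsto) (auto simp: space_pair_measure)
qed

text \<open>The factor \<open>1 / p t (x - y)\<close> is kept as a quotient because positivity of
  the density is not yet known; it will be derived from this formula.\<close>

lemma X_marginal_div:
  assumes s: "0 < s" "s < t" and f: "f \<in> borel_measurable borel"
  shows "(\<integral>\<^sup>+\<omega>. f (X s \<omega>) \<partial>P x y) =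
    (\<integral>\<^sup>+z. ennreal (1 / p t (x - y) * (p s (x - z) * p (t - s) (z - y))) * f z \<partial>lborel)"
proof -
  \<comment> \<open>The shortest admissible list of times: one interior time \<open>s\<close>
    between 0 and \<open>t\<close>.\<close>
  define r where "r j = (if j = 0 then 0 else if j = Suc 0 then s else t)" for j :: nat
  note [measurable] = p_measurable[OF s(1)] f
  have [measurable]: "p (t - s) \<in> borel_measurable borel" using s by (intro p_measurable) simp
  interpret product_sigma_finite "\<lambda>_::nat. lborel :: 'a measure" ..
  have D: "distributed (P x y) (\<Pi>\<^sub>M j\<in>{1..1}. lborel) (\<lambda>\<omega>. \<lambda>j\<in>{1..1}. X (r j) \<omega>)
      (\<lambda>z. ennreal (bridge_density p t x y 1 r z))"
    by (rule X_distributed) (use s in \<open>auto simp: r_def le_Suc_eq\<close>)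
  have "(\<lambda>z. f (z 1)) \<in> borel_measurable (\<Pi>\<^sub>M j\<in>{1..1::nat}. lborel)" by measurable
  from distributed_nn_integral[OF D this]
  have "(\<integral>\<^sup>+\<omega>. f (X s \<omega>) \<partial>P x y) =
      (\<integral>\<^sup>+z. ennreal (bridge_density p t x y 1 r z) * f (z 1) \<partial>(\<Pi>\<^sub>M j\<in>{1..1::nat}. lborel))"
    by (simp add: r_def)
  also have "\<dots> = (\<integral>\<^sup>+z. ennreal (1 / p t (x - y) * (p s (x - z 1) * p (t - s) (z 1 - y))) * f (z 1)
      \<partial>(\<Pi>\<^sub>M j\<in>{1::nat}. lborel))"
    by (simp add: bridge_density_def r_def Let_def)
  also have "\<dots> = (\<integral>\<^sup>+z. ennreal (1 / p t (x - y) * (p s (x - z) * p (t - s) (z - y))) * f z \<partial>lborel)"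
    by (rule product_nn_integral_singleton) measurable
  finally show ?thesis .
qed

text \<open>With the convention \<open>1 / 0 = 0\<close>, a zero of \<open>p t\<close> would make the bridge a null measure.\<close>

lemma p_pos: "0 < p t (x - y)"
proof (rule ccontr)
  assume "\<not> 0 < p t (x - y)"
  with p_nonneg[OF t_pos] have "p t (x - y) = 0" by (simp add: antisym)
  then have "(\<integral>\<^sup>+\<omega>. 1 \<partial>P x y) = 0"
    using X_marginal_div[of "t / 2" "\<lambda>_. 1" x y] t_pos by simp
  then show False using P.emeasure_space_1 by simp
qed

text \<open>Clearing the normalizing factor leaves a product of two densities, each containing only
  one end point, which is the form that can be integrated over both.\<close>

lemma X_marginal:
  assumes s: "0 < s" "s < t" and f[measurable]: "f \<in> borel_measurable borel"
  shows "ennreal (p t (x - y)) * (\<integral>\<^sup>+\<omega>. f (X s \<omega>) \<partial>P x y) =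
    (\<integral>\<^sup>+z. ennreal (p s (x - z) * p (t - s) (z - y)) * f z \<partial>lborel)"
proof -
  note [measurable] = p_measurable[OF s(1)]
  have [measurable]: "p (t - s) \<in> borel_measurable borel" using s by (intro p_measurable) simp
  have "ennreal (p t (x - y)) * (\<integral>\<^sup>+\<omega>. f (X s \<omega>) \<partial>P x y) = (\<integral>\<^sup>+z. ennreal (p t (x - y)) *
      (ennreal (1 / p t (x - y) * (p s (x - z) * p (t - s) (z - y))) * f z) \<partial>lborel)"
    unfolding X_marginal_div[OF s f] by (rule nn_integral_cmult[symmetric]) measurable
  also have "\<dots> = (\<integral>\<^sup>+z. ennreal (p s (x - z) * p (t - s) (z - y)) * f z \<partial>lborel)"
  proof (rule nn_integral_cong)
    fix z
    have "0 \<le> p s (x - z) * p (t - s) (z - y)" using s by (simp add: p_nonneg)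
    then show "ennreal (p t (x - y)) * (ennreal (1 / p t (x - y) * (p s (x - z) * p (t - s) (z - y))) * f z)
        = ennreal (p s (x - z) * p (t - s) (z - y)) * f z"
      using p_pos[of x y] by (simp add: mult.assoc[symmetric] ennreal_mult'[symmetric])
  qed
  finally show ?thesis .
qed

text \<open>The measure \<open>P x y\<close> varies with the end points in an unspecified way, but
  the expectation equals an integral over a fixed product space whose integrand, a bridge density
  times \<open>F\<close>, is jointly measurable. Parameter integrals of this kind are
  measurable.\<close>

lemma finite_dimensional_measurable:
  assumes k: "1 \<le> k" "s 0 = 0" "s (Suc k) = t" "\<And>j. j \<le> k \<Longrightarrow> s j < s (Suc j)"
    and F: "F \<in> borel_measurable (\<Pi>\<^sub>M j\<in>{1..k}. lborel)"
  shows "(\<lambda>z. \<integral>\<omega>. F (\<lambda>j\<in>{1..k}. X (s j) \<omega>) \<partial>P (fst z) (snd z) :: real)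
    \<in> borel_measurable (lborel \<Otimes>\<^sub>M lborel)"
proof -
  let ?Pi = "\<Pi>\<^sub>M j\<in>{1..k}. (lborel :: 'a measure)"
  interpret product_sigma_finite "\<lambda>_::nat. lborel :: 'a measure" ..
  interpret Pi: sigma_finite_measure ?Pi by (rule sigma_finite) simp
  note [measurable] = F p_measurable[OF t_pos]
  have nn: "0 \<le> bridge_density p t x y k s z" for x y z
    unfolding bridge_density_def Let_def using k(4) p_nonneg t_pos
    by (intro mult_nonneg_nonneg prod_nonneg) auto
  \<comment> \<open>The indices 0 and \<open>Suc k\<close> lie outside the index set of the product
    space; their positions come from the end points, hence the case distinction.\<close>
  have w: "(\<lambda>u. ((snd u)(0 := fst (fst u), Suc k := snd (fst u))) j)
      \<in> borel_measurable ((lborel \<Otimes>\<^sub>M lborel) \<Otimes>\<^sub>M ?Pi)" if j: "j \<le> Suc k" for j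
  proof -
    have "j = 0 \<or> j = Suc k \<or> j \<in> {1..k}" using j by auto
    then consider "j = 0" | "j = Suc k" | "j \<in> {1..k}" by blast
    then show ?thesis
    proof cases
      case 3
      then have "j \<noteq> 0" "j \<noteq> Suc k" by auto
      have "(\<lambda>u. snd u j) \<in> borel_measurable ((lborel \<Otimes>\<^sub>M lborel) \<Otimes>\<^sub>M ?Pi)"
        using 3 by measurable
      then show ?thesis using \<open>j \<noteq> 0\<close> \<open>j \<noteq> Suc k\<close> by simp
    qed simp_all
  qed
  have "(\<lambda>u. p (s (Suc j) - s j) (((snd u)(0 := fst (fst u), Suc k := snd (fst u))) j -
        ((snd u)(0 := fst (fst u), Suc k := snd (fst u))) (Suc j)))
      \<in> borel_measurable ((lborel \<Otimes>\<^sub>M lborel) \<Otimes>\<^sub>M ?Pi)" if "j \<in> {0..k}" for j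
  proof -
    have "0 < s (Suc j) - s j" using k(4) that by simp
    from measurable_compose[OF borel_measurable_diff[OF w[of j] w[of "Suc j"]] p_measurable[OF this]] that
    show ?thesis by (simp del: fun_upd_apply)
  qed
  then have "(\<lambda>u. \<Prod>j=0..k. p (s (Suc j) - s j) (((snd u)(0 := fst (fst u), Suc k := snd (fst u))) j -
        ((snd u)(0 := fst (fst u), Suc k := snd (fst u))) (Suc j)))
      \<in> borel_measurable ((lborel \<Otimes>\<^sub>M lborel) \<Otimes>\<^sub>M ?Pi)"
    by (rule borel_measurable_prod)
  moreover have "(\<lambda>u. 1 / p t (fst (fst u) - snd (fst u)))
      \<in> borel_measurable ((lborel \<Otimes>\<^sub>M lborel) \<Otimes>\<^sub>M ?Pi)"
    by measurable
  ultimately have "(\<lambda>u. bridge_density p t (fst (fst u)) (snd (fst u)) k s (snd u))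
      \<in> borel_measurable ((lborel \<Otimes>\<^sub>M lborel) \<Otimes>\<^sub>M ?Pi)"
    unfolding bridge_density_def Let_def by (intro borel_measurable_times)
  moreover have "(\<lambda>u. F (snd u)) \<in> borel_measurable ((lborel \<Otimes>\<^sub>M lborel) \<Otimes>\<^sub>M ?Pi)"
    by measurable
  ultimately have "(\<lambda>u. bridge_density p t (fst (fst u)) (snd (fst u)) k s (snd u) * F (snd u))
      \<in> borel_measurable ((lborel \<Otimes>\<^sub>M lborel) \<Otimes>\<^sub>M ?Pi)"
    by (rule borel_measurable_times)
  then have "(\<lambda>z. \<integral>v. bridge_density p t (fst z) (snd z) k s v * F v \<partial>?Pi)
      \<in> borel_measurable (lborel \<Otimes>\<^sub>M lborel)"
    by (intro Pi.borel_measurable_lebesgue_integral) (simp only: split_beta')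
  also have "(\<lambda>z. \<integral>v. bridge_density p t (fst z) (snd z) k s v * F v \<partial>?Pi) =
      (\<lambda>z. \<integral>\<omega>. F (\<lambda>j\<in>{1..k}. X (s j) \<omega>) \<partial>P (fst z) (snd z))"
    by (intro ext distributed_integral[OF X_distributed[OF k] F nn])
  finally show ?thesis .
qed

end

subsection \<open>Integrals along bridge paths\<close>

lemma integrable_indicator_Icc: "integrable lborel (\<lambda>s. indicator {a..b::real} s * (c::real))"
  and integrable_indicator_Ico: "integrable lborel (\<lambda>s. indicator {a..<b::real} s * (c::real))"
  by (intro integrable_mult_left integrable_real_indicator emeasure_bounded_finite; simp)+

context bridge_family begin

text \<open>Interior times are covered by the finite-dimensional laws. At times 0 and
  \<open>t\<close> there is no density, but the position is almost surely an end point, so the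
  expectation is \<open>f x\<close> or \<open>f y\<close>.\<close>

lemma expectation_X_measurable:
  fixes f :: "'a \<Rightarrow> real"
  assumes f[measurable]: "f \<in> borel_measurable borel"
  shows "(\<lambda>z. \<integral>\<omega>. f (X (clamp s) \<omega>) \<partial>P (fst z) (snd z)) \<in> borel_measurable (lborel \<Otimes>\<^sub>M lborel)"
proof -
  consider "s \<le> 0" | "t \<le> s" | "0 < s" "s < t" by linarith
  then show ?thesis
  proof cases
    case 1
    then have c: "clamp s = 0" using t_pos by (simp add: clamp_def)
    have "(\<integral>\<omega>. f (X 0 \<omega>) \<partial>P x y) = (\<integral>\<omega>. f x \<partial>P x y)" for x y
    proof (rule integral_cong_AE)
      have "X 0 \<in> borel_measurable (P x y)" using t_pos by (intro X_measurable) simp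
      then show "(\<lambda>\<omega>. f (X 0 \<omega>)) \<in> borel_measurable (P x y)" by measurable
      show "AE \<omega> in P x y. f (X 0 \<omega>) = f x" using X_start[where x=x and y=y] by eventually_elim simp
    qed simp
    then show ?thesis by (simp add: c P.prob_space)
  next
    case 2
    then have c: "clamp s = t" using t_pos by (simp add: clamp_def)
    have "(\<integral>\<omega>. f (X t \<omega>) \<partial>P x y) = (\<integral>\<omega>. f y \<partial>P x y)" for x y
    proof (rule integral_cong_AE)
      have "X t \<in> borel_measurable (P x y)" using t_pos by (intro X_measurable) simp
      then show "(\<lambda>\<omega>. f (X t \<omega>)) \<in> borel_measurable (P x y)" by measurable
      show "AE \<omega> in P x y. f (X t \<omega>) = f y" using X_end[where x=x and y=y] by eventually_elim simp
    qed simp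
    then show ?thesis by (simp add: c P.prob_space)
  next
    case 3
    define r where "r j = (if j = 0 then 0 else if j = Suc 0 then s else t)" for j :: nat
    have "(\<lambda>z. \<integral>\<omega>. f ((\<lambda>j\<in>{1..1}. X (r j) \<omega>) 1) \<partial>P (fst z) (snd z))
        \<in> borel_measurable (lborel \<Otimes>\<^sub>M lborel)"
    proof (rule finite_dimensional_measurable)
      show "(\<lambda>v. f (v 1)) \<in> borel_measurable (\<Pi>\<^sub>M j\<in>{1..1::nat}. lborel)" by measurable
    qed (use 3 in \<open>auto simp: r_def le_Suc_eq\<close>)
    then show ?thesis using 3 by (simp add: r_def clamp_eq)
  qed
qed

text \<open>For continuous \<open>f\<close> the expectation is right-continuous in time, so rounding
  time up to the grid reduces joint measurability to fixed times. Dominated convergence carries the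
  result to bounded Borel \<open>f\<close>.\<close>

lemma expectation_X_joint_measurable:
  fixes f :: "'a \<Rightarrow> real"
  assumes f: "f \<in> borel_measurable borel" and C: "\<And>x. \<bar>f x\<bar> \<le> C"
  shows "(\<lambda>u. \<integral>\<omega>. f (X (clamp (fst u)) \<omega>) \<partial>P (fst (snd u)) (snd (snd u)))
    \<in> borel_measurable (lborel \<Otimes>\<^sub>M (lborel \<Otimes>\<^sub>M lborel))"
  using f C
proof (induction rule: bounded_borel_induct)
  case (continuous f)
  have f_meas [measurable]: "f \<in> borel_measurable borel"
    using continuous by (intro borel_measurable_continuous_onI)
  obtain B where B: "\<And>x. \<bar>f x\<bar> \<le> B" using continuous(2) by (auto simp: bounded_iff)
  show ?case
  proof (rule borel_measurable_LIMSEQ_real)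
    fix n
    have "(\<lambda>u. \<integral>\<omega>. f (X (clamp ((of_int i + 1) / real (Suc n))) \<omega>) \<partial>P (fst (snd u)) (snd (snd u)))
        \<in> borel_measurable (lborel \<Otimes>\<^sub>M (lborel \<Otimes>\<^sub>M lborel))" for i
      by (rule measurable_compose[OF measurable_snd expectation_X_measurable[OF f_meas]])
    moreover have "(\<lambda>u. \<lfloor>fst u * real (Suc n)\<rfloor>)
        \<in> measurable (lborel \<Otimes>\<^sub>M (lborel \<Otimes>\<^sub>M lborel)) (count_space UNIV)"
      by measurable
    ultimately show "(\<lambda>u :: real \<times> 'a \<times> 'a.
        \<integral>\<omega>. f (X (clamp ((of_int \<lfloor>fst u * real (Suc n)\<rfloor> + 1) / real (Suc n))) \<omega>)
          \<partial>P (fst (snd u)) (snd (snd u))) \<in> borel_measurable (lborel \<Otimes>\<^sub>M (lborel \<Otimes>\<^sub>M lborel))"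
      by (rule measurable_compose_countable)
  next
    fix u :: "real \<times> 'a \<times> 'a"
    show "(\<lambda>n. \<integral>\<omega>. f (X (clamp ((of_int \<lfloor>fst u * real (Suc n)\<rfloor> + 1) / real (Suc n))) \<omega>)
          \<partial>P (fst (snd u)) (snd (snd u)))
      \<longlonglongrightarrow> (\<integral>\<omega>. f (X (clamp (fst u)) \<omega>) \<partial>P (fst (snd u)) (snd (snd u)))"
    proof (rule integral_dominated_convergence[where w="\<lambda>_. B"])
      show "AE \<omega> in P (fst (snd u)) (snd (snd u)).
        (\<lambda>n. f (X (clamp ((of_int \<lfloor>fst u * real (Suc n)\<rfloor> + 1) / real (Suc n))) \<omega>))
        \<longlonglongrightarrow> f (X (clamp (fst u)) \<omega>)"
      proof (rule AE_I2)
        fix \<omega> assume "\<omega> \<in> space (P (fst (snd u)) (snd (snd u)))"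
        from X_right_limit[OF this upper_grid_tendsto upper_grid_gt]
        show "(\<lambda>n. f (X (clamp ((of_int \<lfloor>fst u * real (Suc n)\<rfloor> + 1) / real (Suc n))) \<omega>))
          \<longlonglongrightarrow> f (X (clamp (fst u)) \<omega>)"
          by (rule continuous_on_tendsto_compose[OF continuous(1)]) auto
      qed
    qed (use B in auto)
  qed
next
  case (limit v g B)
  note [measurable] = limit(1)
  have [measurable]: "g \<in> borel_measurable borel"
    by (rule borel_measurable_LIMSEQ_real[OF limit(3) limit(1)])
  show ?case
  proof (rule borel_measurable_LIMSEQ_real[OF _ limit(4)])
    fix u :: "real \<times> 'a \<times> 'a"
    show "(\<lambda>n. \<integral>\<omega>. v n (X (clamp (fst u)) \<omega>) \<partial>P (fst (snd u)) (snd (snd u)))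
      \<longlonglongrightarrow> (\<integral>\<omega>. g (X (clamp (fst u)) \<omega>) \<partial>P (fst (snd u)) (snd (snd u)))"
      by (rule integral_dominated_convergence[where w="\<lambda>_. B"]) (use limit in auto)
  qed
qed

section \<open>The time integral along a path, written \<open>A\<close> in the overview\<close>

definition occ :: "('a \<Rightarrow> real) \<Rightarrow> 'w \<Rightarrow> real" where
  "occ f \<omega> = (LBINT s:{0..t}. f (X s \<omega>))"

lemma occ_eq: "occ f \<omega> = (LBINT s. indicator {0..t} s * f (X (clamp s) \<omega>))"
  unfolding occ_def set_lebesgue_integral_def
  by (intro Bochner_Integration.integral_cong) (auto simp: indicator_def clamp_eq)

lemma path_measurable:
  assumes "\<omega> \<in> space (P x y)" shows "(\<lambda>s. X (clamp s) \<omega>) \<in> borel_measurable lborel"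
proof -
  have "(\<lambda>s. (s, \<omega>)) \<in> measurable lborel (lborel \<Otimes>\<^sub>M P x y)" using assms by measurable
  from measurable_compose[OF this X_joint_measurable] show ?thesis by simp
qed

lemma path_integrable:
  fixes f :: "'a \<Rightarrow> real"
  assumes "\<omega> \<in> space (P x y)" and f[measurable]: "f \<in> borel_measurable borel" and C: "\<And>x. \<bar>f x\<bar> \<le> C"
  shows "integrable lborel (\<lambda>s. indicator {0..t} s * f (X (clamp s) \<omega>))"
proof (rule Bochner_Integration.integrable_bound)
  note [measurable] = path_measurable[OF assms(1)]
  show "integrable lborel (\<lambda>s. indicator {0..t} s * C)" by (rule integrable_indicator_Icc)
  show "(\<lambda>s. indicator {0..t} s * f (X (clamp s) \<omega>)) \<in> borel_measurable lborel" by measurable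
  show "AE s in lborel. norm (indicator {0..t} s * f (X (clamp s) \<omega>)) \<le> norm (indicator {0..t} s * C)"
    using C by (auto simp: indicator_def intro: order_trans[OF _ abs_ge_self])
qed

lemma occ_measurable:
  assumes f[measurable]: "f \<in> borel_measurable borel"
  shows "occ f \<in> borel_measurable (P x y)"
proof -
  have "(\<lambda>z. indicator {0..t} (snd z) * f (X (clamp (snd z)) (fst z)))
      \<in> borel_measurable (P x y \<Otimes>\<^sub>M lborel)"
  proof -
    have "(\<lambda>z. (snd z, fst z)) \<in> measurable (P x y \<Otimes>\<^sub>M lborel) (lborel \<Otimes>\<^sub>M P x y)" by measurable
    from measurable_compose[OF this X_joint_measurable]
    have [measurable]: "(\<lambda>z. X (clamp (snd z)) (fst z)) \<in> borel_measurable (P x y \<Otimes>\<^sub>M lborel)" by simp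
    show ?thesis by measurable
  qed
  then show ?thesis
    unfolding occ_eq[abs_def] by (intro lborel.borel_measurable_lebesgue_integral) (simp add: split_beta')
qed

lemma occ_mono:
  assumes "\<omega> \<in> space (P x y)" "f \<in> borel_measurable borel" "\<And>x. \<bar>f x\<bar> \<le> C"
    "g \<in> borel_measurable borel" "\<And>x. \<bar>g x\<bar> \<le> D" "\<And>x. f x \<le> g x"
  shows "occ f \<omega> \<le> occ g \<omega>"
  unfolding occ_eq
  by (intro integral_mono path_integrable[OF assms(1)])
     (use assms in \<open>auto simp: indicator_def\<close>)

lemma occ_const: "occ (\<lambda>_. c) \<omega> = t * c"
  using t_pos by (simp add: occ_eq)

lemma occ_uminus: "occ (\<lambda>x. - f x) \<omega> = - occ f \<omega>"
  by (simp add: occ_eq)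

lemma occ_diff:
  assumes "\<omega> \<in> space (P x y)" "f \<in> borel_measurable borel" "\<And>x. \<bar>f x\<bar> \<le> C"
    "g \<in> borel_measurable borel" "\<And>x. \<bar>g x\<bar> \<le> D"
  shows "occ (\<lambda>x. f x - g x) \<omega> = occ f \<omega> - occ g \<omega>"
  using Bochner_Integration.integral_diff[OF path_integrable[OF assms(1-3)] path_integrable[OF assms(1,4,5)]]
  by (simp add: occ_eq right_diff_distrib)

lemma occ_abs_le:
  assumes "\<omega> \<in> space (P x y)" "f \<in> borel_measurable borel" "\<And>x. \<bar>f x\<bar> \<le> C"
  shows "\<bar>occ f \<omega>\<bar> \<le> occ (\<lambda>x. \<bar>f x\<bar>) \<omega>" and "occ (\<lambda>x. \<bar>f x\<bar>) \<omega> \<le> t * C"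
proof -
  have "occ f \<omega> \<le> occ (\<lambda>x. \<bar>f x\<bar>) \<omega>" "occ (\<lambda>x. - f x) \<omega> \<le> occ (\<lambda>x. \<bar>f x\<bar>) \<omega>"
    by (rule occ_mono[OF assms(1), of _ C _ C]; use assms in simp)+
  then show "\<bar>occ f \<omega>\<bar> \<le> occ (\<lambda>x. \<bar>f x\<bar>) \<omega>" by (simp add: occ_uminus)
  have "occ (\<lambda>x. \<bar>f x\<bar>) \<omega> \<le> occ (\<lambda>_. C) \<omega>"
    by (rule occ_mono[OF assms(1), of _ C _ "\<bar>C\<bar>"]) (use assms in auto)
  then show "occ (\<lambda>x. \<bar>f x\<bar>) \<omega> \<le> t * C" by (simp add: occ_const)
qed

lemma occ_tendsto:
  assumes "\<omega> \<in> space (P x y)" and u[measurable]: "\<And>n. u n \<in> borel_measurable borel"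
    and B: "\<And>n x. \<bar>u n x\<bar> \<le> B" and lim: "\<And>x. (\<lambda>n. u n x) \<longlonglongrightarrow> g x"
  shows "(\<lambda>n. occ (u n) \<omega>) \<longlonglongrightarrow> occ g \<omega>"
  unfolding occ_eq
proof (rule integral_dominated_convergence[where w="\<lambda>s. indicator {0..t} s * B"])
  note [measurable] = path_measurable[OF assms(1)]
  have [measurable]: "g \<in> borel_measurable borel" by (rule borel_measurable_LIMSEQ_real[OF lim u])
  show "(\<lambda>s. indicator {0..t} s * g (X (clamp s) \<omega>)) \<in> borel_measurable lborel" by measurable
  show "(\<lambda>s. indicator {0..t} s * u n (X (clamp s) \<omega>)) \<in> borel_measurable lborel" for n by measurable
  show "AE s in lborel. norm (indicator {0..t} s * u n (X (clamp s) \<omega>)) \<le> indicator {0..t} s * B" for n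
    using B by (auto simp: indicator_def)
  show "AE s in lborel. (\<lambda>n. indicator {0..t} s * u n (X (clamp s) \<omega>)) \<longlonglongrightarrow> indicator {0..t} s * g (X (clamp s) \<omega>)"
    using lim by (auto intro!: tendsto_intros)
qed (rule integrable_indicator_Icc)

section \<open>Riemann sums over interior times\<close>

lemma grid_mem: "j \<le> Suc k \<Longrightarrow> real j * t / real (Suc k) \<in> {0..t}"
  using mult_right_mono[of "real j" "real (Suc k)" t] t_pos
  by (simp add: pos_divide_le_eq mult.commute del: of_nat_Suc)

text \<open>The interval is cut into \<open>Suc k\<close> cells and the path is sampled at their
  right ends. The last cell is left out because its right end is \<open>t\<close>, which is not an
  interior time of the bridge; its length tends to 0. Each sum is the integral of a step function
  \<open>S k\<close> converging pointwise by right continuity.\<close>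

lemma Riemann_sum_tendsto_occ:
  assumes w: "\<omega> \<in> space (P x y)" and f: "continuous_on UNIV f" and B: "\<And>x. \<bar>f x\<bar> \<le> B"
  shows "(\<lambda>k. \<Sum>j=1..k. t / real (Suc k) * f (X (real j * t / real (Suc k)) \<omega>)) \<longlonglongrightarrow> occ f \<omega>"
proof -
  \<comment> \<open>\<open>t * g k s\<close> is the right end of the cell that contains
    \<open>s\<close>.\<close>
  define g where "g k s = (of_int \<lfloor>s / t * real (Suc k)\<rfloor> + 1) / real (Suc k)" for k s
  define S where "S k s = indicator {0..<real k * t / real (Suc k)} s * f (X (clamp (t * g k s)) \<omega>)" for k s
  \<comment> \<open>The definition of \<open>S\<close> suits the pointwise limit, the sum over cells
    suits the integral.\<close>
  have S_sum: "S k s = (\<Sum>j=1..k. indicator {(real j - 1) * t / real (Suc k)..<real j * t / real (Suc k)} s *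
      f (X (real j * t / real (Suc k)) \<omega>))" for k s
  proof -
    \<comment> \<open>Cells are numbered from 1 and closed on the left, so \<open>s\<close> belongs
      to the cell with number \<open>m + 1\<close>.\<close>
    define m where "m = \<lfloor>s / t * real (Suc k)\<rfloor>"
    have ind: "s \<in> {(real j - 1) * t / real (Suc k)..<real j * t / real (Suc k)} \<longleftrightarrow> int j = m + 1" for j
    proof -
      have "s \<in> {(real j - 1) * t / real (Suc k)..<real j * t / real (Suc k)} \<longleftrightarrow>
          of_int (int j - 1) \<le> s / t * real (Suc k) \<and> s / t * real (Suc k) < of_int (int j - 1) + 1"
        using t_pos by (simp add: pos_divide_le_eq pos_le_divide_eq pos_less_divide_eq pos_divide_less_eq del: of_nat_Suc)
      also have "\<dots> \<longleftrightarrow> m = int j - 1" unfolding m_def floor_eq_iff by simp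
      finally show ?thesis by auto
    qed
    have ind0: "s \<in> {0..<real k * t / real (Suc k)} \<longleftrightarrow> m + 1 \<in> {1..int k}"
    proof -
      have "s \<in> {0..<real k * t / real (Suc k)} \<longleftrightarrow>
          of_int 0 \<le> s / t * real (Suc k) \<and> s / t * real (Suc k) < of_int (int k)"
        using t_pos by (simp add: pos_divide_le_eq pos_le_divide_eq pos_less_divide_eq pos_divide_less_eq zero_le_divide_iff
          zero_le_mult_iff del: of_nat_Suc)
      also have "\<dots> \<longleftrightarrow> m + 1 \<in> {1..int k}" unfolding m_def by (simp add: le_floor_iff floor_less_iff) linarith
      finally show ?thesis .
    qed
    show ?thesis
    proof (cases "m + 1 \<in> {1..int k}")
      case True
      define i where "i = nat (m + 1)"
      have i: "i \<in> {1..k}" "int i = m + 1" using True by (auto simp: i_def)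
      have "(\<Sum>j=1..k. indicator {(real j - 1) * t / real (Suc k)..<real j * t / real (Suc k)} s *
          f (X (real j * t / real (Suc k)) \<omega>)) =
          (\<Sum>j=1..k. if j = i then f (X (real j * t / real (Suc k)) \<omega>) else 0)"
        by (intro sum.cong refl) (simp only: indicator_def ind i(2)[symmetric] of_nat_eq_iff, simp)
      also have "\<dots> = f (X (real i * t / real (Suc k)) \<omega>)" using i(1) by simp
      also have "real i * t / real (Suc k) = clamp (t * g k s)"
      proof -
        have "real i * t / real (Suc k) \<in> {0..t}"
          using i(1) by (intro grid_mem) simp
        moreover have "t * g k s = real i * t / real (Suc k)"
          using i(2) unfolding g_def m_def[symmetric] by (metis mult.commute of_int_1 of_int_add of_int_of_nat_eq times_divide_eq_right)
        ultimately show ?thesis by (simp add: clamp_eq)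
      qed
      finally show ?thesis using True by (simp only: S_def indicator_def ind0) simp
    next
      case False
      have "(\<Sum>j=1..k. indicator {(real j - 1) * t / real (Suc k)..<real j * t / real (Suc k)} s *
          f (X (real j * t / real (Suc k)) \<omega>)) = 0"
      proof (intro sum.neutral ballI)
        fix j assume "j \<in> {1..k}"
        then have "int j \<noteq> m + 1" using False by auto
        then show "indicator {(real j - 1) * t / real (Suc k)..<real j * t / real (Suc k)} s *
            f (X (real j * t / real (Suc k)) \<omega>) = 0" by (simp only: indicator_def ind) simp
      qed
      with False show ?thesis by (simp only: S_def indicator_def ind0) simp
    qed
  qed
  have S_int: "integral\<^sup>L lborel (S k) = (\<Sum>j=1..k. t / real (Suc k) * f (X (real j * t / real (Suc k)) \<omega>))" for k
  proof -
    have "integral\<^sup>L lborel (S k) =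
      (\<Sum>j=1..k. measure lborel {(real j - 1) * t / real (Suc k)..<real j * t / real (Suc k)} *
        f (X (real j * t / real (Suc k)) \<omega>))"
      unfolding S_sum[abs_def] by (subst Bochner_Integration.integral_sum[OF integrable_indicator_Ico]) simp
    also have "\<dots> = (\<Sum>j=1..k. t / real (Suc k) * f (X (real j * t / real (Suc k)) \<omega>))"
    proof (intro sum.cong refl)
      fix j
      have "(real j - 1) * t / real (Suc k) \<le> real j * t / real (Suc k)"
        using t_pos by (intro divide_right_mono mult_right_mono) auto
      then have "measure lborel {(real j - 1) * t / real (Suc k)..<real j * t / real (Suc k)} =
          real j * t / real (Suc k) - (real j - 1) * t / real (Suc k)" by simp
      also have "\<dots> = t / real (Suc k)" by (simp add: diff_divide_distrib[symmetric] algebra_simps del: of_nat_Suc)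
      finally show "measure lborel {(real j - 1) * t / real (Suc k)..<real j * t / real (Suc k)} *
        f (X (real j * t / real (Suc k)) \<omega>) = t / real (Suc k) * f (X (real j * t / real (Suc k)) \<omega>)" by simp
    qed
    finally show ?thesis .
  qed
  have "(\<lambda>k. integral\<^sup>L lborel (S k)) \<longlonglongrightarrow> (LBINT s. indicator {0..<t} s * f (X (clamp s) \<omega>))"
  proof (rule integral_dominated_convergence[where w="\<lambda>s. indicator {0..t} s * B"])
    have "f \<in> borel_measurable borel" using f by (rule borel_measurable_continuous_onI)
    note [measurable] = path_measurable[OF w] this
    show "(\<lambda>s. indicator {0..<t} s * f (X (clamp s) \<omega>)) \<in> borel_measurable lborel" by measurable
    show "S k \<in> borel_measurable lborel" for k
      unfolding S_sum[abs_def] by measurable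
    have sub: "real k * t / real (Suc k) \<le> t" for k using t_pos by (simp add: field_simps)
    show "AE s in lborel. norm (S k s) \<le> indicator {0..t} s * B" for k
      using B sub[of k] order_trans[OF abs_ge_zero B] by (intro AE_I2) (auto simp: S_def indicator_def)
    show "AE s in lborel. (\<lambda>k. S k s) \<longlonglongrightarrow> indicator {0..<t} s * f (X (clamp s) \<omega>)"
    unfolding S_def
    proof (intro AE_I2 tendsto_mult)
      fix s
      have grid: "(\<lambda>k. t * g k s) \<longlonglongrightarrow> s"
        using tendsto_mult_left[OF upper_grid_tendsto[of "s / t"], of t] t_pos by (simp add: g_def)
      have "s < t * g k s" for k
        using mult_strict_left_mono[OF upper_grid_gt[of "s / t" k] t_pos] t_pos by (simp add: g_def)
      from X_right_limit[OF w grid this]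
      show "(\<lambda>k. f (X (clamp (t * g k s)) \<omega>)) \<longlonglongrightarrow> f (X (clamp s) \<omega>)"
        by (rule continuous_on_tendsto_compose[OF f]) auto
      have lim1: "(\<lambda>k. real k * t / real (Suc k)) \<longlonglongrightarrow> t"
        using tendsto_mult_right[OF LIMSEQ_n_over_Suc_n, of t] by simp
      show "(\<lambda>k. indicator {0..<real k * t / real (Suc k)} s :: real) \<longlonglongrightarrow> indicator {0..<t} s"
      proof (cases "s < t")
        case True
        have "eventually (\<lambda>k. s < real k * t / real (Suc k)) sequentially"
          by (rule order_tendstoD(1)[OF lim1 True])
        then have "eventually (\<lambda>k. indicator {0..<real k * t / real (Suc k)} s = (indicator {0..<t} s :: real)) sequentially"
          by eventually_elim (use True in \<open>auto simp: indicator_def\<close>)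
        then show ?thesis by (rule tendsto_eventually)
      next
        case False
        then have "indicator {0..<real k * t / real (Suc k)} s = (indicator {0..<t} s :: real)" for k
          using sub[of k] by (auto simp: indicator_def)
        then show ?thesis by simp
      qed
    qed
  qed (rule integrable_indicator_Icc)
  \<comment> \<open>The two integrands can differ only at \<open>s = t\<close>.\<close>
  also have "(LBINT s. indicator {0..<t} s * f (X (clamp s) \<omega>)) = occ f \<omega>"
    unfolding occ_eq
  proof (rule integral_cong_AE)
    have "f \<in> borel_measurable borel" using f by (rule borel_measurable_continuous_onI)
    note [measurable] = path_measurable[OF w] this
    show "(\<lambda>s. indicator {0..<t} s * f (X (clamp s) \<omega>)) \<in> borel_measurable lborel"
      "(\<lambda>s. indicator {0..t} s * f (X (clamp s) \<omega>)) \<in> borel_measurable lborel" by measurable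
    show "AE s in lborel. indicator {0..<t} s * f (X (clamp s) \<omega>) = indicator {0..t} s * f (X (clamp s) \<omega>)"
      using AE_lborel_singleton[of t] by eventually_elim (auto simp: indicator_def)
  qed
  finally show ?thesis by (simp add: S_int)
qed

end

subsection \<open>Averaging over the end points\<close>

context bridge_family begin

text \<open>For continuous \<open>f\<close> a Riemann sum is a function of finitely many interior
  positions, so its exponential is covered by the finite-dimensional laws. The bound
  \<open>exp (t * B)\<close> serves as the dominating constant in both limits, over Riemann sums and
  over approximants of \<open>f\<close>.\<close>

lemma expectation_exp_occ_measurable:
  fixes f :: "'a \<Rightarrow> real"
  assumes f: "f \<in> borel_measurable borel" and C: "\<And>x. \<bar>f x\<bar> \<le> C"
  shows "(\<lambda>z. \<integral>\<omega>. exp (- occ f \<omega>) \<partial>P (fst z) (snd z)) \<in> borel_measurable (lborel \<Otimes>\<^sub>M lborel)"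
  using f C
proof (induction rule: bounded_borel_induct)
  case (continuous f)
  have f_meas [measurable]: "f \<in> borel_measurable borel"
    using continuous by (intro borel_measurable_continuous_onI)
  obtain B where B: "\<And>x. \<bar>f x\<bar> \<le> B" using continuous(2) by (auto simp: bounded_iff)
  then have "0 \<le> B" using abs_ge_zero order_trans by blast
  define R where "R k \<omega> = (\<Sum>j=1..k. t / real (Suc k) * f (X (real j * t / real (Suc k)) \<omega>))" for k \<omega>
  show ?case
  proof (rule borel_measurable_LIMSEQ_real)
    fix k
    show "(\<lambda>z. \<integral>\<omega>. exp (- R k \<omega>) \<partial>P (fst z) (snd z)) \<in> borel_measurable (lborel \<Otimes>\<^sub>M lborel)"
    \<comment> \<open>The finite-dimensional laws need at least one interior time; for
      \<open>k = 0\<close> the Riemann sum is empty.\<close>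
    proof (cases "k = 0")
      case True
      then show ?thesis by (simp add: R_def P.prob_space)
    next
      case False
      have "(\<lambda>z. \<integral>\<omega>. (\<lambda>v. exp (- (\<Sum>j=1..k. t / real (Suc k) * f (v j))))
          (\<lambda>j\<in>{1..k}. X (real j * t / real (Suc k)) \<omega>) \<partial>P (fst z) (snd z))
          \<in> borel_measurable (lborel \<Otimes>\<^sub>M lborel)"
      proof (rule finite_dimensional_measurable)
        show "real j * t / real (Suc k) < real (Suc j) * t / real (Suc k)" for j
          using t_pos by (intro divide_strict_right_mono mult_strict_right_mono) auto
        show "(\<lambda>v. exp (- (\<Sum>j=1..k. t / real (Suc k) * f (v j)))) \<in> borel_measurable (\<Pi>\<^sub>M j\<in>{1..k}. lborel)"
          by measurable
      qed (use False in auto)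
      then show ?thesis by (simp add: R_def cong: sum.cong_simp)
    qed
  next
    fix z :: "'a \<times> 'a"
    show "(\<lambda>k. \<integral>\<omega>. exp (- R k \<omega>) \<partial>P (fst z) (snd z)) \<longlonglongrightarrow> (\<integral>\<omega>. exp (- occ f \<omega>) \<partial>P (fst z) (snd z))"
    proof (rule integral_dominated_convergence[where w="\<lambda>_. exp (t * B)"])
      note [measurable] = occ_measurable[OF f_meas]
      show "(\<lambda>\<omega>. exp (- occ f \<omega>)) \<in> borel_measurable (P (fst z) (snd z))" by measurable
      have [measurable]: "X (real j * t / real (Suc k)) \<in> borel_measurable (P (fst z) (snd z))"
        if "j \<in> {1..k}" for j k
        by (rule X_measurable[OF grid_mem]) (use that in simp)
      show "(\<lambda>\<omega>. exp (- R k \<omega>)) \<in> borel_measurable (P (fst z) (snd z))" for k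
        unfolding R_def by measurable
      show "AE \<omega> in P (fst z) (snd z). (\<lambda>k. exp (- R k \<omega>)) \<longlonglongrightarrow> exp (- occ f \<omega>)"
        unfolding R_def
        by (intro AE_I2 tendsto_intros Riemann_sum_tendsto_occ[OF _ continuous(1) B])
      show "AE \<omega> in P (fst z) (snd z). norm (exp (- R k \<omega>)) \<le> exp (t * B)" for k
      proof (rule AE_I2)
        fix \<omega>
        have "\<bar>R k \<omega>\<bar> \<le> (\<Sum>j=1..k. t / real (Suc k) * B)"
          unfolding R_def
        proof (rule order_trans[OF sum_abs sum_mono])
          fix j
          show "\<bar>t / real (Suc k) * f (X (real j * t / real (Suc k)) \<omega>)\<bar> \<le> t / real (Suc k) * B"
            unfolding abs_mult using t_pos B by (intro mult_mono) auto
        qed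
        also have "\<dots> = (real k / real (Suc k)) * (t * B)" by simp
        also have "\<dots> \<le> 1 * (t * B)"
          using t_pos \<open>0 \<le> B\<close> by (intro mult_right_mono) auto
        finally show "norm (exp (- R k \<omega>)) \<le> exp (t * B)" by simp
      qed
    qed simp
  qed
next
  case (limit v g B)
  have g: "g \<in> borel_measurable borel"
    by (rule borel_measurable_LIMSEQ_real[OF limit(3) limit(1)])
  note [measurable] = occ_measurable[OF g] occ_measurable[OF limit(1)]
  show ?case
  proof (rule borel_measurable_LIMSEQ_real[OF _ limit(4)])
    fix z :: "'a \<times> 'a"
    show "(\<lambda>n. \<integral>\<omega>. exp (- occ (v n) \<omega>) \<partial>P (fst z) (snd z))
      \<longlonglongrightarrow> (\<integral>\<omega>. exp (- occ g \<omega>) \<partial>P (fst z) (snd z))"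
    proof (rule integral_dominated_convergence[where w="\<lambda>_. exp (t * B)"])
      show "AE \<omega> in P (fst z) (snd z). (\<lambda>n. exp (- occ (v n) \<omega>)) \<longlonglongrightarrow> exp (- occ g \<omega>)"
        by (intro AE_I2 tendsto_intros occ_tendsto[OF _ limit(1) limit(2) limit(3)])
      show "AE \<omega> in P (fst z) (snd z). norm (exp (- occ (v n) \<omega>)) \<le> exp (t * B)" for n
      proof (rule AE_I2)
        fix \<omega> assume "\<omega> \<in> space (P (fst z) (snd z))"
        from occ_abs_le[OF this limit(1)[of n] limit(2)[of n]]
        show "norm (exp (- occ (v n) \<omega>)) \<le> exp (t * B)" by simp
      qed
    qed simp_all
  qed
qed

end

section \<open>Integrating out the end points\<close>

lemma nn_integral_lborel_translate:
  fixes g :: "'a::euclidean_space \<Rightarrow> ennreal"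
  assumes [measurable]: "g \<in> borel_measurable borel"
  shows "(\<integral>\<^sup>+x. g (x - z) \<partial>lborel) = (\<integral>\<^sup>+x. g x \<partial>lborel)"
    and "(\<integral>\<^sup>+x. g (z - x) \<partial>lborel) = (\<integral>\<^sup>+x. g x \<partial>lborel)"
proof -
  show "(\<integral>\<^sup>+x. g (x - z) \<partial>lborel) = (\<integral>\<^sup>+x. g x \<partial>lborel)"
    by (subst (2) lborel_distr_plus[symmetric, of "- z"]) (simp add: nn_integral_distr)
  show "(\<integral>\<^sup>+x. g (z - x) \<partial>lborel) = (\<integral>\<^sup>+x. g x \<partial>lborel)"
    by (subst (2) lborel_affine[of "-1" z]) (simp_all add: nn_integral_density nn_integral_distr density_1)
qed

context bridge_family begin

text \<open>With the intermediate point \<open>z\<close> held fixed, each density contains one end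
  point, and after a translation or reflection each end point integrates to mass one. Tonelli
  permits doing this before integrating over \<open>z\<close>.\<close>

lemma nn_integral_two_step:
  assumes s: "0 < s" "s < t" and f[measurable]: "f \<in> borel_measurable borel"
  shows "(\<integral>\<^sup>+u. (\<integral>\<^sup>+z. ennreal (p s (fst u - z) * p (t - s) (z - snd u)) * f z \<partial>lborel) \<partial>(lborel \<Otimes>\<^sub>M lborel))
    = (\<integral>\<^sup>+z. f z \<partial>lborel)"
proof -
  interpret L: pair_sigma_finite lborel "lborel \<Otimes>\<^sub>M lborel :: ('a \<times> 'a) measure"
    unfolding lborel_prod by (simp add: pair_sigma_finite_def sigma_finite_lborel)
  have ts: "0 < t - s" using s by simp
  note [measurable] = p_measurable[OF s(1)] p_measurable[OF ts]
  have "(\<integral>\<^sup>+u. (\<integral>\<^sup>+z. ennreal (p s (fst u - z) * p (t - s) (z - snd u)) * f z \<partial>lborel) \<partial>(lborel \<Otimes>\<^sub>M lborel))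
    = (\<integral>\<^sup>+z. (\<integral>\<^sup>+u. ennreal (p s (fst u - z) * p (t - s) (z - snd u)) * f z \<partial>(lborel \<Otimes>\<^sub>M lborel)) \<partial>lborel)"
    by (rule L.Fubini') measurable
  also have "\<dots> = (\<integral>\<^sup>+z. f z \<partial>lborel)"
  proof (rule nn_integral_cong)
    fix z
    have "(\<integral>\<^sup>+u. ennreal (p s (fst u - z) * p (t - s) (z - snd u)) * f z \<partial>(lborel \<Otimes>\<^sub>M lborel)) =
        (\<integral>\<^sup>+x. (\<integral>\<^sup>+y. (ennreal (p s (x - z)) * f z) * ennreal (p (t - s) (z - y)) \<partial>lborel) \<partial>lborel)"
      by (subst lborel.nn_integral_fst[symmetric])
         (auto simp: ennreal_mult' p_nonneg s mult_ac intro!: nn_integral_cong)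
    also have "\<dots> = (\<integral>\<^sup>+x. (ennreal (p s (x - z)) * f z) * (\<integral>\<^sup>+y. ennreal (p (t - s) (z - y)) \<partial>lborel) \<partial>lborel)"
      by (intro nn_integral_cong nn_integral_cmult) measurable
    also have "\<dots> = (\<integral>\<^sup>+x. ennreal (p s (x - z)) * f z \<partial>lborel)"
      using nn_integral_lborel_translate(2)[of "\<lambda>y. ennreal (p (t - s) y)" z] p_mass[OF ts] by simp
    also have "\<dots> = (\<integral>\<^sup>+x. ennreal (p s (x - z)) \<partial>lborel) * f z"
      by (rule nn_integral_multc) measurable
    also have "\<dots> = f z"
      using nn_integral_lborel_translate(1)[of "\<lambda>y. ennreal (p s y)" z] p_mass[OF s(1)] by simp
    finally show "(\<integral>\<^sup>+u. ennreal (p s (fst u - z) * p (t - s) (z - snd u)) * f z \<partial>(lborel \<Otimes>\<^sub>M lborel)) = f z" .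
  qed
  finally show ?thesis .
qed

text \<open>Tonelli for path and time. The inner expectation remains a Bochner integral because its
  joint measurability in time and end points is known in that form.\<close>

lemma nn_expectation_occ:
  assumes f[measurable]: "f \<in> borel_measurable borel" and C: "\<And>x. 0 \<le> f x" "\<And>x. f x \<le> C"
  shows "(\<integral>\<^sup>+\<omega>. ennreal (occ f \<omega>) \<partial>P x y) =
    (\<integral>\<^sup>+s. indicator {0..t} s * ennreal (\<integral>\<omega>. f (X (clamp s) \<omega>) \<partial>P x y) \<partial>lborel)"
proof -
  interpret L: pair_sigma_finite lborel "P x y" ..
  note [measurable] = X_joint_measurable[of x y]
  have abs: "\<bar>f x\<bar> \<le> C" for x using C by simp
  have "(\<integral>\<^sup>+\<omega>. ennreal (occ f \<omega>) \<partial>P x y) =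
      (\<integral>\<^sup>+\<omega>. (\<integral>\<^sup>+s. indicator {0..t} s * ennreal (f (X (clamp s) \<omega>)) \<partial>lborel) \<partial>P x y)"
  proof (rule nn_integral_cong)
    fix \<omega> assume w: "\<omega> \<in> space (P x y)"
    have "ennreal (occ f \<omega>) = (\<integral>\<^sup>+s. ennreal (indicator {0..t} s * f (X (clamp s) \<omega>)) \<partial>lborel)"
      unfolding occ_eq
      by (rule nn_integral_eq_integral[symmetric, OF path_integrable[OF w f abs]]) (simp add: C)
    then show "ennreal (occ f \<omega>) = (\<integral>\<^sup>+s. indicator {0..t} s * ennreal (f (X (clamp s) \<omega>)) \<partial>lborel)"
      by (simp add: ennreal_mult' ennreal_indicator)
  qed
  also have "\<dots> = (\<integral>\<^sup>+s. (\<integral>\<^sup>+\<omega>. indicator {0..t} s * ennreal (f (X (clamp s) \<omega>)) \<partial>P x y) \<partial>lborel)"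
    by (rule L.Fubini') (simp add: split_beta')
  also have "\<dots> = (\<integral>\<^sup>+s. indicator {0..t} s * ennreal (\<integral>\<omega>. f (X (clamp s) \<omega>) \<partial>P x y) \<partial>lborel)"
  proof (rule nn_integral_cong)
    fix s
    have "(\<integral>\<^sup>+\<omega>. indicator {0..t} s * ennreal (f (X (clamp s) \<omega>)) \<partial>P x y) =
        indicator {0..t} s * (\<integral>\<^sup>+\<omega>. ennreal (f (X (clamp s) \<omega>)) \<partial>P x y)"
      by (rule nn_integral_cmult) measurable
    also have "(\<integral>\<^sup>+\<omega>. ennreal (f (X (clamp s) \<omega>)) \<partial>P x y) = ennreal (\<integral>\<omega>. f (X (clamp s) \<omega>) \<partial>P x y)"
      by (rule nn_integral_eq_integral[OF P.integrable_const_bound[where B=C]]) (auto simp: C)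
    finally show "(\<integral>\<^sup>+\<omega>. indicator {0..t} s * ennreal (f (X (clamp s) \<omega>)) \<partial>P x y) =
      indicator {0..t} s * ennreal (\<integral>\<omega>. f (X (clamp s) \<omega>) \<partial>P x y)" .
  qed
  finally show ?thesis .
qed

lemma nn_integral_weighted_occ:
  assumes f[measurable]: "f \<in> borel_measurable borel" and C: "\<And>x. 0 \<le> f x" "\<And>x. f x \<le> C"
  shows "(\<lambda>u. \<integral>\<^sup>+\<omega>. ennreal (occ f \<omega>) \<partial>P (fst u) (snd u)) \<in> borel_measurable (lborel \<Otimes>\<^sub>M lborel)" (is ?M)
    and "(\<integral>\<^sup>+u. ennreal (p t (fst u - snd u)) * (\<integral>\<^sup>+\<omega>. ennreal (occ f \<omega>) \<partial>P (fst u) (snd u)) \<partial>(lborel \<Otimes>\<^sub>M lborel))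
      = ennreal t * (\<integral>\<^sup>+z. ennreal (f z) \<partial>lborel)" (is ?I)
proof -
  interpret L: pair_sigma_finite lborel "lborel \<Otimes>\<^sub>M lborel :: ('a \<times> 'a) measure"
    unfolding lborel_prod by (simp add: pair_sigma_finite_def sigma_finite_lborel)
  note [measurable] = p_measurable[OF t_pos]
  have abs: "\<bar>f x\<bar> \<le> C" for x using C by simp
  define E where "E s u = (\<integral>\<omega>. f (X (clamp s) \<omega>) \<partial>P (fst u) (snd u))" for s u
  have E[measurable]: "(\<lambda>w. E (fst w) (snd w)) \<in> borel_measurable (lborel \<Otimes>\<^sub>M (lborel \<Otimes>\<^sub>M lborel))"
    unfolding E_def by (rule expectation_X_joint_measurable[OF f abs])
  have E'[measurable]: "(\<lambda>w. E (snd w) (fst w)) \<in> borel_measurable ((lborel \<Otimes>\<^sub>M lborel) \<Otimes>\<^sub>M lborel)"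
    using measurable_compose[OF measurable_pair_swap' E] by (simp add: split_beta')
  have occ_E: "(\<integral>\<^sup>+\<omega>. ennreal (occ f \<omega>) \<partial>P (fst u) (snd u)) =
      (\<integral>\<^sup>+s. indicator {0..t} s * ennreal (E s u) \<partial>lborel)" for u
    unfolding E_def by (rule nn_expectation_occ[OF f C])
  show ?M
    unfolding occ_E by (intro lborel.borel_measurable_nn_integral) (simp add: split_beta')
  have E_sec[measurable]: "(\<lambda>s. E s u) \<in> borel_measurable lborel" for u
  proof -
    have "(\<lambda>s. (s, u)) \<in> measurable lborel (lborel \<Otimes>\<^sub>M (lborel \<Otimes>\<^sub>M lborel))"
      by (rule measurable_Pair2') (simp add: space_pair_measure)
    from measurable_compose[OF this E] show ?thesis by simp
  qed
  \<comment> \<open>The marginal formula holds at interior times; the two excluded times form a null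
    set.\<close>
  have inner: "(\<integral>\<^sup>+u. ennreal (p t (fst u - snd u)) * (indicator {0..t} s * ennreal (E s u)) \<partial>(lborel \<Otimes>\<^sub>M lborel))
      = indicator {0..t} s * (\<integral>\<^sup>+z. ennreal (f z) \<partial>lborel)" if "s \<noteq> 0" "s \<noteq> t" for s
  proof (cases "s \<in> {0..t}")
    case True
    then have s: "0 < s" "s < t" using that by auto
    have "ennreal (p t (fst u - snd u)) * ennreal (E s u) =
        (\<integral>\<^sup>+z. ennreal (p s (fst u - z) * p (t - s) (z - snd u)) * ennreal (f z) \<partial>lborel)" for u
    proof -
      have "X s \<in> borel_measurable (P (fst u) (snd u))" using True by (rule X_measurable)
      note [measurable] = this
      have "ennreal (E s u) = (\<integral>\<^sup>+\<omega>. ennreal (f (X s \<omega>)) \<partial>P (fst u) (snd u))"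
        unfolding E_def clamp_eq[OF True]
        by (rule nn_integral_eq_integral[symmetric, OF P.integrable_const_bound[where B=C]]) (auto simp: C)
      then show ?thesis using X_marginal[OF s, of "\<lambda>z. ennreal (f z)" "fst u" "snd u"] by simp
    qed
    then show ?thesis using True nn_integral_two_step[OF s, of "\<lambda>z. ennreal (f z)"] by simp
  qed simp
  have "(\<integral>\<^sup>+u. ennreal (p t (fst u - snd u)) * (\<integral>\<^sup>+\<omega>. ennreal (occ f \<omega>) \<partial>P (fst u) (snd u)) \<partial>(lborel \<Otimes>\<^sub>M lborel))
      = (\<integral>\<^sup>+u. (\<integral>\<^sup>+s. ennreal (p t (fst u - snd u)) * (indicator {0..t} s * ennreal (E s u)) \<partial>lborel) \<partial>(lborel \<Otimes>\<^sub>M lborel))"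
    unfolding occ_E by (intro nn_integral_cong nn_integral_cmult[symmetric]) measurable
  also have "\<dots> = (\<integral>\<^sup>+s. (\<integral>\<^sup>+u. ennreal (p t (fst u - snd u)) * (indicator {0..t} s * ennreal (E s u)) \<partial>(lborel \<Otimes>\<^sub>M lborel)) \<partial>lborel)"
    by (rule L.Fubini') (simp add: split_beta')
  also have "\<dots> = (\<integral>\<^sup>+s. indicator {0..t} s * (\<integral>\<^sup>+z. ennreal (f z) \<partial>lborel) \<partial>lborel)"
    using AE_lborel_singleton[of 0] AE_lborel_singleton[of t]
    by (intro nn_integral_cong_AE) (auto elim!: eventually_elim2 intro: inner)
  also have "\<dots> = ennreal t * (\<integral>\<^sup>+z. ennreal (f z) \<partial>lborel)"
    using t_pos by (subst nn_integral_multc) auto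
  finally show ?I .
qed

text \<open>Up to sign, the first-order term of the heat content before integration over the end
  points.\<close>

definition weighted_occ :: "('a \<Rightarrow> real) \<Rightarrow> 'a \<times> 'a \<Rightarrow> real" where
  "weighted_occ f u = p t (fst u - snd u) * (\<integral>\<omega>. occ f \<omega> \<partial>P (fst u) (snd u))"

lemma occ_integrable:
  assumes f: "f \<in> borel_measurable borel" and C: "\<And>x. \<bar>f x\<bar> \<le> C"
  shows "integrable (P x y) (occ f)"
proof (rule P.integrable_const_bound[where B="t * C"])
  show "AE \<omega> in P x y. norm (occ f \<omega>) \<le> t * C"
    using occ_abs_le[OF _ f C] by (intro AE_I2) (force intro: order_trans)
qed (rule occ_measurable[OF f])

lemma weighted_occ_nonneg_integral:
  assumes f: "f \<in> borel_measurable borel" and C: "\<And>x. 0 \<le> f x" "\<And>x. f x \<le> C" and int: "integrable lborel f"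
  shows "integrable (lborel \<Otimes>\<^sub>M lborel) (weighted_occ f) \<and>
    integral\<^sup>L (lborel \<Otimes>\<^sub>M lborel) (weighted_occ f) = t * integral\<^sup>L lborel f"
proof -
  note [measurable] = p_measurable[OF t_pos] nn_integral_weighted_occ(1)[OF f C]
  have abs: "\<bar>f x\<bar> \<le> C" for x using C by simp
  have occ_nn: "0 \<le> occ f \<omega>" for \<omega>
    unfolding occ_eq using C by (intro integral_nonneg_AE) simp
  have eq: "ennreal (\<integral>\<omega>. occ f \<omega> \<partial>P x y) = (\<integral>\<^sup>+\<omega>. ennreal (occ f \<omega>) \<partial>P x y)" for x y
    by (rule nn_integral_eq_integral[symmetric, OF occ_integrable[OF f abs]]) (simp add: occ_nn)
  \<comment> \<open>Measurability in the end points is available for the nonnegative integral;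
    \<open>enn2real\<close> carries it over to the Bochner integral.\<close>
  have eq': "(\<integral>\<omega>. occ f \<omega> \<partial>P x y) = enn2real (\<integral>\<^sup>+\<omega>. ennreal (occ f \<omega>) \<partial>P x y)" for x y
    using occ_nn by (simp add: eq[symmetric] integral_nonneg_AE)
  have "weighted_occ f \<in> borel_measurable (lborel \<Otimes>\<^sub>M lborel)"
    unfolding weighted_occ_def[abs_def] eq' by measurable
  moreover have "0 \<le> weighted_occ f u" for u
    unfolding weighted_occ_def using occ_nn p_nonneg[OF t_pos]
    by (intro mult_nonneg_nonneg integral_nonneg_AE) auto
  moreover have "(\<integral>\<^sup>+u. ennreal (weighted_occ f u) \<partial>(lborel \<Otimes>\<^sub>M lborel)) = ennreal (t * integral\<^sup>L lborel f)"
    unfolding weighted_occ_def using nn_integral_weighted_occ(2)[OF f C] t_pos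
    by (simp add: ennreal_mult' p_nonneg[OF t_pos] eq nn_integral_eq_integral[OF int] C integral_nonneg_AE)
  moreover have "0 \<le> t * integral\<^sup>L lborel f"
    using t_pos C by (simp add: integral_nonneg_AE)
  ultimately show ?thesis by (subst (asm) nn_integral_eq_integrable) auto
qed

lemma weighted_occ_integral:
  assumes f[measurable]: "f \<in> borel_measurable borel" and C: "\<And>x. \<bar>f x\<bar> \<le> C" and int: "integrable lborel f"
  shows "integrable (lborel \<Otimes>\<^sub>M lborel) (weighted_occ f)"
    and "integral\<^sup>L (lborel \<Otimes>\<^sub>M lborel) (weighted_occ f) = t * integral\<^sup>L lborel f"
proof -
  define g where "g x = max 0 (f x)" for x
  define h where "h x = max 0 (- f x)" for x
  have gh[measurable]: "g \<in> borel_measurable borel" "h \<in> borel_measurable borel"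
    unfolding g_def[abs_def] h_def[abs_def] by measurable
  have bd: "0 \<le> g x" "g x \<le> C" "\<bar>g x\<bar> \<le> C" "0 \<le> h x" "h x \<le> C" "\<bar>h x\<bar> \<le> C" for x
    using C[of x] by (auto simp: g_def h_def)
  have igh: "integrable lborel g" "integrable lborel h"
    unfolding g_def[abs_def] h_def[abs_def] using int by simp_all
  have f_eq: "f = (\<lambda>x. g x - h x)" by (auto simp: g_def h_def)
  have W: "weighted_occ f u = weighted_occ g u - weighted_occ h u" for u
  proof -
    have "(\<integral>\<omega>. occ f \<omega> \<partial>P (fst u) (snd u)) = (\<integral>\<omega>. occ g \<omega> - occ h \<omega> \<partial>P (fst u) (snd u))"
      unfolding f_eq
      by (rule Bochner_Integration.integral_cong[OF refl occ_diff[OF _ gh(1) bd(3) gh(2) bd(6)]])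
    also have "\<dots> = (\<integral>\<omega>. occ g \<omega> \<partial>P (fst u) (snd u)) - (\<integral>\<omega>. occ h \<omega> \<partial>P (fst u) (snd u))"
      by (rule Bochner_Integration.integral_diff[OF occ_integrable[OF gh(1) bd(3)] occ_integrable[OF gh(2) bd(6)]])
    finally show ?thesis by (simp add: weighted_occ_def right_diff_distrib)
  qed
  note G = weighted_occ_nonneg_integral[OF gh(1) bd(1,2) igh(1)]
  note H = weighted_occ_nonneg_integral[OF gh(2) bd(4,5) igh(2)]
  show "integrable (lborel \<Otimes>\<^sub>M lborel) (weighted_occ f)"
    unfolding W[abs_def] using G H by simp
  show "integral\<^sup>L (lborel \<Otimes>\<^sub>M lborel) (weighted_occ f) = t * integral\<^sup>L lborel f"
    unfolding W[abs_def] using G H igh by (simp add: f_eq right_diff_distrib)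
qed

end

subsection \<open>Heat content\<close>

text \<open>Taylor expansion to second order, with the exponential in the remainder at most
  \<open>exp b\<close>. Of the two factors \<open>\<bar>a\<bar>\<close> only one is replaced by
  \<open>b\<close>; the other is kept so that averaging it produces the norm of \<open>V\<close> in
  \<open>L1\<close>.\<close>

lemma exp_minus_remainder_bound:
  fixes a b :: real
  assumes "\<bar>a\<bar> \<le> b"
  shows "\<bar>exp (- a) - 1 + a\<bar> \<le> (b * exp b / 2) * \<bar>a\<bar>"
proof -
  obtain r where r: "\<bar>r\<bar> \<le> \<bar>- a\<bar>" "exp (- a) = (\<Sum>m<2. (- a) ^ m / fact m) + exp r / fact 2 * (- a) ^ 2"
    using Maclaurin_exp_le[of "- a" 2] by blast
  have "exp (- a) - 1 + a = exp r / 2 * (\<bar>a\<bar> * \<bar>a\<bar>)"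
    using r(2) by (simp add: numeral_2_eq_2)
  moreover have "0 \<le> exp r / 2 * (\<bar>a\<bar> * \<bar>a\<bar>)" by simp
  ultimately have "\<bar>exp (- a) - 1 + a\<bar> = exp r / 2 * (\<bar>a\<bar> * \<bar>a\<bar>)" by (simp only: abs_of_nonneg)
  also have "\<dots> \<le> exp b / 2 * (b * \<bar>a\<bar>)"
    using assms r(1) by (intro mult_mono) (auto intro: mult_right_mono)
  finally show ?thesis by (simp add: mult_ac)
qed

context bridge_family begin

text \<open>At an interior time the position has a density, so it almost surely avoids the null set
  where \<open>f\<close> and \<open>g\<close> differ. Exchanging the quantifiers over time and path
  shows that almost every path spends no time there. This makes the heat content independent of the
  representative of \<open>V\<close>.\<close>

lemma occ_AE_cong:
  assumes f[measurable]: "f \<in> borel_measurable borel" and g[measurable]: "g \<in> borel_measurable borel"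
    and fg: "AE x in lborel. f x = g x"
  shows "AE \<omega> in P x y. occ f \<omega> = occ g \<omega>"
proof -
  interpret L: pair_sigma_finite lborel "P x y" ..
  note [measurable] = X_joint_measurable[of x y]
  have ae: "AE \<omega> in P x y. s \<in> {0..t} \<longrightarrow> f (X (clamp s) \<omega>) = g (X (clamp s) \<omega>)" if "s \<noteq> 0" "s \<noteq> t" for s
  proof (cases "s \<in> {0..t}")
    case True
    then have s: "0 < s" "s < t" using that by auto
    note [measurable] = X_measurable[OF True, of x y]
    have "(\<integral>\<^sup>+\<omega>. indicator {z. f z \<noteq> g z} (X s \<omega>) \<partial>P x y) =
        (\<integral>\<^sup>+z. ennreal (1 / p t (x - y) * (p s (x - z) * p (t - s) (z - y))) * indicator {z. f z \<noteq> g z} z \<partial>lborel)"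
      by (rule X_marginal_div[OF s]) measurable
    also have "\<dots> = (\<integral>\<^sup>+z. 0 \<partial>(lborel :: 'a measure))"
      using fg by (intro nn_integral_cong_AE) (auto elim!: eventually_mono)
    finally have "(\<integral>\<^sup>+\<omega>. indicator {z. f z \<noteq> g z} (X s \<omega>) \<partial>P x y) = 0" by simp
    then have "AE \<omega> in P x y. indicator {z. f z \<noteq> g z} (X s \<omega>) = (0 :: ennreal)"
      by (subst (asm) nn_integral_0_iff_AE) measurable
    then show ?thesis by eventually_elim (auto simp: clamp_eq[OF True] indicator_def split: if_splits)
  qed auto
  have "AE s in lborel. AE \<omega> in P x y. s \<in> {0..t} \<longrightarrow> f (X (clamp s) \<omega>) = g (X (clamp s) \<omega>)"
    using AE_lborel_singleton[of 0] AE_lborel_singleton[of t] by eventually_elim (rule ae)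
  then have "AE \<omega> in P x y. AE s in lborel. s \<in> {0..t} \<longrightarrow> f (X (clamp s) \<omega>) = g (X (clamp s) \<omega>)"
    by (subst (asm) L.AE_commute) measurable
  then show ?thesis
    using AE_space
  proof eventually_elim
    case (elim \<omega>)
    note [measurable] = path_measurable[OF elim(2)]
    show ?case
      unfolding occ_eq
    proof (rule integral_cong_AE)
      show "AE s in lborel. indicator {0..t} s * f (X (clamp s) \<omega>) = indicator {0..t} s * g (X (clamp s) \<omega>)"
        using elim(1) by eventually_elim (auto simp: indicator_def)
    qed measurable
  qed
qed

text \<open>The integrand of the heat content as a function on the product space, where Fubini
  applies.\<close>

definition heat_gap :: "('a \<Rightarrow> real) \<Rightarrow> 'a \<times> 'a \<Rightarrow> real" where
  "heat_gap V u = p t (fst u - snd u) * (\<integral>\<omega>. exp (- occ V \<omega>) \<partial>P (fst u) (snd u)) - p t (fst u - snd u)"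

lemma heat_gap_AE_cong:
  assumes f: "f \<in> borel_measurable borel" and g: "g \<in> borel_measurable borel"
    and "AE x in lborel. f x = g x"
  shows "heat_gap f = heat_gap g"
proof
  fix u
  note [measurable] = occ_measurable[OF f] occ_measurable[OF g]
  have "(\<integral>\<omega>. exp (- occ f \<omega>) \<partial>P (fst u) (snd u)) = (\<integral>\<omega>. exp (- occ g \<omega>) \<partial>P (fst u) (snd u))"
    using occ_AE_cong[OF assms, of "fst u" "snd u"]
    by (intro integral_cong_AE) (auto elim: eventually_mono)
  then show "heat_gap f u = heat_gap g u" by (simp add: heat_gap_def)
qed

text \<open>Adding \<open>weighted_occ V\<close> turns the expectation of
  \<open>exp (- A) - 1\<close> into that of the second-order remainder
  \<open>exp (- A) - 1 + A\<close>, which is nonnegative whatever the sign of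
  \<open>V\<close>.\<close>

lemma heat_gap_bounds:
  assumes V: "V \<in> borel_measurable borel" and N: "\<And>x. \<bar>V x\<bar> \<le> N"
  shows "0 \<le> heat_gap V u + weighted_occ V u"
    and "heat_gap V u + weighted_occ V u \<le> (t * N * exp (t * N) / 2) * weighted_occ (\<lambda>x. \<bar>V x\<bar>) u"
proof -
  let ?P = "P (fst u) (snd u)"
  let ?c = "t * N * exp (t * N) / 2"
  have aV: "(\<lambda>x. \<bar>V x\<bar>) \<in> borel_measurable borel" using V by measurable
  note [measurable] = occ_measurable[OF V]
  have N0: "0 \<le> t * N" using t_pos N order_trans[OF abs_ge_zero N] by simp
  have le: "\<bar>occ V \<omega>\<bar> \<le> t * N" "\<bar>occ V \<omega>\<bar> \<le> occ (\<lambda>x. \<bar>V x\<bar>) \<omega>" if "\<omega> \<in> space ?P" for \<omega>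
    using occ_abs_le[OF that V N] by auto
  have i1: "integrable ?P (\<lambda>\<omega>. exp (- occ V \<omega>))"
    by (rule P.integrable_const_bound[where B="exp (t * N)"]) (use le in \<open>fastforce intro!: AE_I2\<close>, measurable)
  have i2: "integrable ?P (occ V)" by (rule occ_integrable[OF V N])
  have i3: "integrable ?P (occ (\<lambda>x. \<bar>V x\<bar>))" by (rule occ_integrable[OF aV]) (use N in simp)
  have eq: "heat_gap V u + weighted_occ V u =
      p t (fst u - snd u) * (\<integral>\<omega>. exp (- occ V \<omega>) - 1 + occ V \<omega> \<partial>?P)"
    using i1 i2 by (simp add: heat_gap_def weighted_occ_def P.prob_space algebra_simps)
  have "0 \<le> (\<integral>\<omega>. exp (- occ V \<omega>) - 1 + occ V \<omega> \<partial>?P)"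
    by (intro integral_nonneg_AE AE_I2) (use exp_ge_add_one_self[of "- occ V _"] in \<open>simp add: algebra_simps\<close>)
  then show "0 \<le> heat_gap V u + weighted_occ V u"
    unfolding eq by (intro mult_nonneg_nonneg p_nonneg t_pos)
  have "(\<integral>\<omega>. exp (- occ V \<omega>) - 1 + occ V \<omega> \<partial>?P) \<le> (\<integral>\<omega>. ?c * occ (\<lambda>x. \<bar>V x\<bar>) \<omega> \<partial>?P)"
  proof (rule integral_mono)
    fix \<omega> assume w: "\<omega> \<in> space ?P"
    have "exp (- occ V \<omega>) - 1 + occ V \<omega> \<le> ?c * \<bar>occ V \<omega>\<bar>"
      by (rule abs_le_D1[OF exp_minus_remainder_bound[OF le(1)[OF w]]])
    also have "\<dots> \<le> ?c * occ (\<lambda>x. \<bar>V x\<bar>) \<omega>"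
      using le(2)[OF w] N0 by (intro mult_left_mono) auto
    finally show "exp (- occ V \<omega>) - 1 + occ V \<omega> \<le> ?c * occ (\<lambda>x. \<bar>V x\<bar>) \<omega>" .
  qed (use i1 i2 i3 in auto)
  then have "(\<integral>\<omega>. exp (- occ V \<omega>) - 1 + occ V \<omega> \<partial>?P) \<le> ?c * (\<integral>\<omega>. occ (\<lambda>x. \<bar>V x\<bar>) \<omega> \<partial>?P)" by simp
  from mult_left_mono[OF this p_nonneg[OF t_pos, of "fst u - snd u"]]
  show "heat_gap V u + weighted_occ V u \<le> ?c * weighted_occ (\<lambda>x. \<bar>V x\<bar>) u"
    unfolding eq by (simp only: weighted_occ_def mult.left_commute)
qed

lemma heat_gap_integral_bounds:
  assumes V: "V \<in> borel_measurable borel" and N: "\<And>x. \<bar>V x\<bar> \<le> N" and int: "integrable lborel V"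
  defines "Q \<equiv> LBINT x. LBINT y. heat_gap V (x, y)"
  shows "0 \<le> Q + t * integral\<^sup>L lborel V"
    and "Q + t * integral\<^sup>L lborel V \<le> (t * N * exp (t * N) / 2) * (t * (LBINT x. \<bar>V x\<bar>))"
proof -
  let ?c = "t * N * exp (t * N) / 2"
  let ?L = "lborel \<Otimes>\<^sub>M lborel :: ('a \<times> 'a) measure"
  have aV: "(\<lambda>x. \<bar>V x\<bar>) \<in> borel_measurable borel" using V by measurable
  note [measurable] = p_measurable[OF t_pos] expectation_exp_occ_measurable[OF V N]
  note W = weighted_occ_integral[OF V N int]
  have aW: "integrable ?L (weighted_occ (\<lambda>x. \<bar>V x\<bar>))"
    "integral\<^sup>L ?L (weighted_occ (\<lambda>x. \<bar>V x\<bar>)) = t * (LBINT x. \<bar>V x\<bar>)"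
    using weighted_occ_integral[OF aV, of N] N int by simp_all
  have "heat_gap V \<in> borel_measurable ?L" unfolding heat_gap_def[abs_def] by measurable
  \<comment> \<open>The remainder is dominated by an integrable function. Subtracting the integrable
    first-order term then makes \<open>heat_gap V\<close> itself integrable, as the passage from the
    iterated to the double integral requires.\<close>
  then have sum: "integrable ?L (\<lambda>u. heat_gap V u + weighted_occ V u)"
  proof (rule Bochner_Integration.integrable_bound[OF integrable_mult_right[OF aW(1), of ?c]
        borel_measurable_add[OF _ borel_measurable_integrable[OF W(1)]]])
    show "AE u in ?L. norm (heat_gap V u + weighted_occ V u) \<le> norm (?c * weighted_occ (\<lambda>x. \<bar>V x\<bar>) u)"
      using heat_gap_bounds[OF V N] by (intro AE_I2) (simp add: order_trans[OF _ abs_ge_self])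
  qed
  from Bochner_Integration.integrable_diff[OF this W(1)] have gap: "integrable ?L (heat_gap V)" by simp
  have "Q = integral\<^sup>L ?L (heat_gap V)"
    unfolding Q_def by (rule lborel_pair.integral_fst'[OF gap])
  then have Q: "Q + t * integral\<^sup>L lborel V = integral\<^sup>L ?L (\<lambda>u. heat_gap V u + weighted_occ V u)"
    using gap W by simp
  show "0 \<le> Q + t * integral\<^sup>L lborel V"
    unfolding Q by (intro integral_nonneg_AE AE_I2 heat_gap_bounds[OF V N])
  have "integral\<^sup>L ?L (\<lambda>u. heat_gap V u + weighted_occ V u) \<le> integral\<^sup>L ?L (\<lambda>u. ?c * weighted_occ (\<lambda>x. \<bar>V x\<bar>) u)"
    by (rule integral_mono[OF sum]) (use aW(1) heat_gap_bounds[OF V N] in auto)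
  then show "Q + t * integral\<^sup>L lborel V \<le> ?c * (t * (LBINT x. \<bar>V x\<bar>))"
    unfolding Q by (simp add: aW(2))
qed

end

section \<open>From essential bounds to pointwise bounds, and the conclusion\<close>

lemma Linf_AE_bound:
  fixes V :: "'a::euclidean_space \<Rightarrow> real"
  assumes "Linf V"
  shows "AE x in lborel. \<bar>V x\<bar> \<le> Linf_norm V" and "0 \<le> Linf_norm V"
proof -
  let ?e = "esssup lborel (\<lambda>x. ereal \<bar>V x\<bar>)"
  have ae: "AE x in lborel. ereal \<bar>V x\<bar> \<le> ?e" by (rule esssup_AE)
  have nn: "0 \<le> ?e"
  proof (rule ccontr)
    assume "\<not> 0 \<le> ?e"
    then have neg: "\<not> ereal \<bar>V x\<bar> \<le> ?e" for x
      using order_trans[of 0 "ereal \<bar>V x\<bar>" ?e] by auto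
    \<comment> \<open>A negative essential supremum would bound \<open>\<bar>V x\<bar>\<close> at no
      point, so the whole space would be a null set.\<close>
    from ae have "AE x in lborel. (x :: 'a) \<in> {}" by eventually_elim (use neg in blast)
    then have "emeasure (lborel :: 'a measure) UNIV = 0"
      by (simp add: AE_iff_measurable[of UNIV])
    then show False by simp
  qed
  then show "0 \<le> Linf_norm V" unfolding Linf_norm_def by (simp add: real_of_ereal_pos)
  \<comment> \<open>Finiteness and nonnegativity exclude both infinities, which
    \<open>real_of_ereal\<close> would send to 0.\<close>
  have "?e = ereal (Linf_norm V)"
    using nn assms unfolding Linf_norm_def Linf_def by (cases ?e) auto
  with ae show "AE x in lborel. \<bar>V x\<bar> \<le> Linf_norm V" by simp
qed

lemma bridge_family_of_stable:
  assumes p: "stable_transition_density \<alpha> p"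
    and "\<And>x y. stable_bridge p t x y (P x y) X" and "0 < t"
  shows "bridge_family p t P X"
proof
  show "0 < t" "\<And>x y. stable_bridge p t x y (P x y) X" by fact+
  fix s :: real assume s: "0 < s"
  with p have ps: "continuous_on UNIV (p s)" "\<And>y. 0 \<le> p s y" "integrable lborel (p s)"
    "(LBINT y. exp (- \<i> * complex_of_real (y \<bullet> \<xi>)) * complex_of_real (p s y)) =
              complex_of_real (exp (- s * norm \<xi> powr \<alpha>))" for \<xi>
    unfolding stable_transition_density_def by blast+
  show "continuous_on UNIV (p s)" "0 \<le> p s y" for y by fact+
  \<comment> \<open>The Fourier identity at frequency 0 gives the total mass, as
    \<open>0 powr \<alpha>\<close> is 0.\<close>
  have "complex_of_real (LBINT y. p s y) = 1" using ps(4)[of 0] by simp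
  then have "(LBINT y. p s y) = 1" by (metis of_real_eq_1_iff)
  then show "(\<integral>\<^sup>+y. ennreal (p s y) \<partial>lborel) = 1"
    using nn_integral_eq_integral[OF ps(3)] ps(2) by simp
qed

lemma heat_content_bounds:
  fixes V :: "'a::euclidean_space \<Rightarrow> real"
  assumes "bridge_family p t (P t) X" and "Linf V" and int: "integrable lborel V"
  shows "0 \<le> heat_content p P X V t + t * (LBINT x. V x)"
    and "heat_content p P X V t + t * (LBINT x. V x)
      \<le> 1/2 * t\<^sup>2 * L1_norm V * Linf_norm V * exp (t * Linf_norm V)"
proof -
  interpret bridge_family p t "P t" X by fact
  let ?N = "Linf_norm V"
  \<comment> \<open>The estimates so far ask for a bound at every point, whereas \<open>V\<close>
    obeys its bound almost everywhere. Truncation at the norm yields a representative with the same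
    integrals and the same heat content.\<close>
  define U where "U x = max (- ?N) (min ?N (V x))" for x
  have V[measurable]: "V \<in> borel_measurable borel" using assms(2) by (simp add: Linf_def)
  have U[measurable]: "U \<in> borel_measurable borel" unfolding U_def[abs_def] by measurable
  have N: "\<bar>U x\<bar> \<le> ?N" for x using Linf_AE_bound(2)[OF assms(2)] by (auto simp: U_def)
  have VU: "AE x in lborel. V x = U x"
    using Linf_AE_bound(1)[OF assms(2)] by eventually_elim (auto simp: U_def)
  have intU: "integrable lborel U"
    using int by (rule integrable_cong_AE_imp) (use VU in \<open>auto elim: eventually_mono\<close>)
  have eqs: "integral\<^sup>L lborel U = integral\<^sup>L lborel V" "(LBINT x. \<bar>U x\<bar>) = L1_norm V"
    unfolding L1_norm_def using VU by (auto intro!: integral_cong_AE elim: eventually_mono)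
  have Q: "heat_content p P X V t = (LBINT x. LBINT y. heat_gap U (x, y))"
    unfolding heat_gap_AE_cong[OF V U VU, symmetric]
    by (simp add: heat_content_def heat_kernel_def heat_gap_def occ_def)
  show "0 \<le> heat_content p P X V t + t * (LBINT x. V x)"
    using heat_gap_integral_bounds(1)[OF U N intU] by (simp add: Q eqs)
  show "heat_content p P X V t + t * (LBINT x. V x)
      \<le> 1/2 * t\<^sup>2 * L1_norm V * Linf_norm V * exp (t * Linf_norm V)"
    using heat_gap_integral_bounds(2)[OF U N intU] by (simp add: Q eqs power2_eq_square mult_ac)
qed

theorem theorem1p1:
  fixes \<alpha> :: real
    and p :: "real \<Rightarrow> 'a::euclidean_space \<Rightarrow> real"
    and P :: "real \<Rightarrow> 'a \<Rightarrow> 'a \<Rightarrow> 'w measure"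
    and X :: "real \<Rightarrow> 'w \<Rightarrow> 'a"
    and V :: "'a \<Rightarrow> real"
  assumes "0 < \<alpha>" and "\<alpha> \<le> 2"
    and "stable_transition_density \<alpha> p"
    and "\<And>t x y. 0 < t \<Longrightarrow> stable_bridge p t x y (P t x y) X"
    and "Linf V" and "integrable lborel V"
  shows
    "((\<forall>x. V x \<le> 0) \<longrightarrow>
        (\<forall>t>0. - t * (LBINT x. V x) \<le> heat_content p P X V t \<and>
               heat_content p P X V t \<le>
                 - t * (LBINT x. V x) * (1 + 1/2 * t * Linf_norm V * exp (t * Linf_norm V))) \<and>
        (\<lambda>t. heat_content p P X V t - (- t * (LBINT x. V x))) \<in> O[at_right 0](\<lambda>t. t\<^sup>2)) \<and>
     ((\<forall>t>0. \<bar>heat_content p P X V t + t * (LBINT x. V x)\<bar>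
               \<le> t\<^sup>2 * L1_norm V * Linf_norm V * exp (t * Linf_norm V)) \<and>
      (\<lambda>t. heat_content p P X V t - (- t * (LBINT x. V x))) \<in> O[at_right 0](\<lambda>t. t\<^sup>2))"
proof -
  let ?Q = "heat_content p P X V" and ?I = "LBINT x. V x" and ?N = "Linf_norm V"
  have bridge: "bridge_family p t (P t) X" if "0 < t" for t
    using bridge_family_of_stable[OF assms(3) assms(4)] that by blast
  note lower = heat_content_bounds(1)[where P=P, OF bridge assms(5,6)]
    and upper = heat_content_bounds(2)[where P=P, OF bridge assms(5,6)]
  have N0: "0 \<le> ?N" by (rule Linf_AE_bound(2)[OF assms(5)])
  have L0: "0 \<le> L1_norm V" unfolding L1_norm_def by simp
  have part1: "- t * ?I \<le> ?Q t \<and> ?Q t \<le> - t * ?I * (1 + 1/2 * t * ?N * exp (t * ?N))"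
    if "\<forall>x. V x \<le> 0" "0 < t" for t
  proof -
    \<comment> \<open>For nonpositive \<open>V\<close> this identity turns the general upper bound
      into the stated one, with the factor one half preserved.\<close>
    have "L1_norm V = - ?I"
      unfolding L1_norm_def using that(1) by (simp add: abs_of_nonpos)
    then show ?thesis
      using lower[OF that(2)] upper[OF that(2)] by (simp add: power2_eq_square algebra_simps)
  qed
  have part2: "\<bar>?Q t + t * ?I\<bar> \<le> t\<^sup>2 * L1_norm V * ?N * exp (t * ?N)" if "0 < t" for t
  proof -
    \<comment> \<open>The deviation lies between 0 and half of this quantity, so nonnegativity
      suffices for the two-sided bound.\<close>
    have "0 \<le> t\<^sup>2 * L1_norm V * ?N * exp (t * ?N)" using N0 L0 by simp
    then show ?thesis using lower[OF that] upper[OF that] by simp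
  qed
  have "(\<lambda>t. ?Q t - (- t * ?I)) \<in> O[at_right 0](\<lambda>t. t\<^sup>2)"
  proof (rule bigoI)
    show "\<forall>\<^sub>F t in at_right 0. norm (?Q t - (- t * ?I)) \<le> (L1_norm V * ?N * exp ?N) * norm (t\<^sup>2)"
      \<comment> \<open>Restricting to \<open>t < 1\<close> bounds \<open>exp (t * ?N)\<close> by
        the constant \<open>exp ?N\<close>.\<close>
      using eventually_at_right_real[of 0 1, simplified]
    proof eventually_elim
      case (elim t)
      have "\<bar>?Q t + t * ?I\<bar> \<le> (t\<^sup>2 * L1_norm V * ?N) * exp (t * ?N)" using part2 elim by simp
      also have "\<dots> \<le> (t\<^sup>2 * L1_norm V * ?N) * exp ?N"
        using elim N0 L0 by (intro mult_left_mono) (auto intro: mult_left_le_one_le)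
      finally show ?case by (simp add: mult_ac)
    qed
  qed
  with part1 part2 show ?thesis by blast
qed

end
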